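(* Let $p>2$ be an odd prime, $G'$ a finite group of order prime to $p$, $H'$ a subgroup of $G'$, and $(V,\rho)$ an $H'$-extremal $\mathbb{F}_p$-representation of $G'$. Put $\overline{G}:=\rho(G')$ and $\overline{H}:=\rho(H')$. (i) One of the following holds: (1) $\overline{G}\cong C_{d}$ and $\overline{H}=\{1\}$, where $d\geq3$ is a divisor of $p-1$ or of $p+1$; (2) $\overline{G}\cong D_{d'}$ and $\#\overline{H}\leq 2$, where $d'\geq3$ is an odd divisor of $p-1$ or of $p+1$. (ii) If $\#\overline{G}$ is a multiple of $4$ and $s:=\mathrm{ord}_{2}(\#\overline{G})\geq 2$, then $p\equiv 1\bmod 2^{s}$ and $\overline{G}$ is cyclic.
   Context: An $\mathbb{F}_p$-representation $(V,\rho)$ of $G'$ is $H'$-extremal if $\dim_{\mathbb{F}_p}V=2$, $V^{G'}=\{0\}$, and there is a 1-dimensional subspace $L\subset V$ with $H'\subset\mathrm{Stab}_{G'}(L)=\mathrm{Fix}_{G'}(L)$ (stabilizer and pointwise stabilizer). $C_n$ is cyclic of order $n$, $D_n$ dihedral of order $2n$; $\mathrm{ord}_2$ is the $2$-adic valuation. *)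

theory Defs
  imports
    "HOL-Algebra.Elementary_Groups"
    "HOL-Number_Theory.Cong"
    "Berlekamp_Zassenhaus.Finite_Field"
begin

text \<open>
  A vector space is a whole type \<^typ>\<open>'v\<close> with a scalar multiplication \<open>scale\<close>
  satisfying the locale \<^locale>\<open>vector_space\<close>. The prime field with \<open>p\<close> elements is
  \<^typ>\<open>'p::prime_card mod_ring\<close>, where \<open>p = CARD('p)\<close>.
\<close>

definition general_linear_group ::
    "('k::field \<Rightarrow> 'v::ab_group_add \<Rightarrow> 'v) \<Rightarrow> ('v \<Rightarrow> 'v) monoid" where
  "general_linear_group scale =
     \<lparr>carrier = {f. Vector_Spaces.linear scale scale f \<and> bij f}, monoid.mult = (\<circ>), one = id\<rparr>"

definition group_representation ::
    "('g, 'm) monoid_scheme \<Rightarrow> ('k::field \<Rightarrow> 'v::ab_group_add \<Rightarrow> 'v) \<Rightarrow> ('g \<Rightarrow> 'v \<Rightarrow> 'v) \<Rightarrow> bool" where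
  "group_representation G scale \<rho> \<longleftrightarrow>
     group G \<and> vector_space scale \<and> \<rho> \<in> hom G (general_linear_group scale)"

definition invariants :: "('g, 'm) monoid_scheme \<Rightarrow> ('g \<Rightarrow> 'v \<Rightarrow> 'v) \<Rightarrow> 'v set" where
  "invariants G \<rho> = {v. \<forall>g \<in> carrier G. \<rho> g v = v}"

definition setwise_stabilizer ::
    "('g, 'm) monoid_scheme \<Rightarrow> ('g \<Rightarrow> 'v \<Rightarrow> 'v) \<Rightarrow> 'v set \<Rightarrow> 'g set" where
  "setwise_stabilizer G \<rho> L = {g \<in> carrier G. \<rho> g ` L = L}"

definition pointwise_stabilizer ::
    "('g, 'm) monoid_scheme \<Rightarrow> ('g \<Rightarrow> 'v \<Rightarrow> 'v) \<Rightarrow> 'v set \<Rightarrow> 'g set" where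
  "pointwise_stabilizer G \<rho> L = {g \<in> carrier G. \<forall>v \<in> L. \<rho> g v = v}"

definition extremal_representation ::
    "('g, 'm) monoid_scheme \<Rightarrow> 'g set \<Rightarrow> ('k::field \<Rightarrow> 'v::ab_group_add \<Rightarrow> 'v) \<Rightarrow>
     ('g \<Rightarrow> 'v \<Rightarrow> 'v) \<Rightarrow> bool" where
  "extremal_representation G H scale \<rho> \<longleftrightarrow>
     group_representation G scale \<rho> \<and>
     vector_space.dim scale (UNIV :: 'v set) = 2 \<and>
     invariants G \<rho> = {0} \<and>
     (\<exists>L. module.subspace scale L \<and> vector_space.dim scale L = 1 \<and>
          H \<subseteq> setwise_stabilizer G \<rho> L \<and>
          setwise_stabilizer G \<rho> L = pointwise_stabilizer G \<rho> L)"

definition representation_image ::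
    "('g, 'm) monoid_scheme \<Rightarrow> ('k::field \<Rightarrow> 'v::ab_group_add \<Rightarrow> 'v) \<Rightarrow> ('g \<Rightarrow> 'v \<Rightarrow> 'v) \<Rightarrow>
     ('v \<Rightarrow> 'v) monoid" where
  "representation_image G scale \<rho> = (general_linear_group scale)\<lparr>carrier := \<rho> ` carrier G\<rparr>"

text \<open>
  The dihedral group of order \<open>2n\<close> for \<open>n \<ge> 1\<close>, as the semidirect product of the integers modulo \<open>n\<close>
  by the inversion: with \<open>r\<close> the generating rotation and \<open>s\<close> a reflection, \<open>(a, False)\<close> stands for
  \<open>r^a\<close> and \<open>(a, True)\<close> for \<open>r^a s\<close>, and \<open>s r s = r^(-1)\<close>.
\<close>

definition dihedral_group :: "nat \<Rightarrow> (int \<times> bool) monoid" where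
  "dihedral_group n =
     \<lparr>carrier = {0..<int n} \<times> UNIV,
      monoid.mult = (\<lambda>(a, x) (b, y). ((if x then a - b else a + b) mod int n, x \<noteq> y)),
      one = (0, False)\<rparr>"

lemma group_general_linear_group:
  assumes "vector_space scale"
  shows "group (general_linear_group scale)"
proof -
  interpret V: vector_space scale by fact
  show ?thesis
  proof (rule groupI)
    fix f assume "f \<in> carrier (general_linear_group scale)"
    then have f: "Vector_Spaces.linear scale scale f" "bij f"
      by (auto simp: general_linear_group_def)
    interpret f: Vector_Spaces.linear scale scale f by (fact f)
    have fi: "f (inv_into UNIV f y) = y" for y
      using f(2) by (simp add: bij_is_surj surj_f_inv_f)
    have eq: "inv_into UNIV f y = x" if "f x = y" for x y
      using that f(2) by (auto simp: bij_is_inj)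
    have "Vector_Spaces.linear scale scale (inv_into UNIV f)"
      unfolding Vector_Spaces.linear_iff
      by (auto intro!: eq simp: f.add f.scale fi V.vector_space_axioms)
    moreover have "bij (inv_into UNIV f)" "inv_into UNIV f \<circ> f = id"
      using f by (auto simp: bij_imp_bij_inv bij_is_inj)
    ultimately show "\<exists>g \<in> carrier (general_linear_group scale).
        g \<otimes>\<^bsub>general_linear_group scale\<^esub> f = \<one>\<^bsub>general_linear_group scale\<^esub>"
      by (auto simp: general_linear_group_def)
  qed (auto simp: general_linear_group_def V.linear_id intro: bij_comp Vector_Spaces.linear_compose)
qed

lemma group_representation_image:
  assumes "group_representation G scale \<rho>"
  shows "group (representation_image G scale \<rho>)"
proof -
  have "group_hom G (general_linear_group scale) \<rho>"
    using assms by (simp add: group_representation_def group_hom_def group_hom_axioms_def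
        group_general_linear_group)
  then show ?thesis
    unfolding representation_image_def
    by (metis group_hom.img_is_subgroup group_general_linear_group assms
        group_representation_def subgroup.subgroup_is_group)
qed

lemma group_dihedral_group:
  assumes "n > 0"
  shows "group (dihedral_group n)"
proof (rule groupI)
  fix u assume "u \<in> carrier (dihedral_group n)"
  then obtain a x where u: "u = (a, x)" "0 \<le> a" "a < int n"
    by (auto simp: dihedral_group_def)
  then show "\<exists>w \<in> carrier (dihedral_group n).
      w \<otimes>\<^bsub>dihedral_group n\<^esub> u = \<one>\<^bsub>dihedral_group n\<^esub>"
    using assms
    by (intro bexI[of _ "(if x then a else (- a) mod int n, x)"])
       (auto simp: dihedral_group_def mod_simps)
next
  fix u v w
  show "u \<otimes>\<^bsub>dihedral_group n\<^esub> v \<otimes>\<^bsub>dihedral_group n\<^esub> w =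
      u \<otimes>\<^bsub>dihedral_group n\<^esub> (v \<otimes>\<^bsub>dihedral_group n\<^esub> w)"
    by (cases u; cases v; cases w) (simp add: dihedral_group_def mod_simps algebra_simps)
qed (use assms in \<open>auto simp: dihedral_group_def\<close>)

lemma order_dihedral_group: "Coset.order (dihedral_group n) = 2 * n"
  by (simp add: Coset.order_def dihedral_group_def card_cartesian_product)

end

theory Submission
  imports Defs "HOL-Algebra.Algebraic_Closure_Type" "HOL-Algebra.Sylow"
begin

text \<open>
  In a basis whose first vector spans \<open>L\<close>, the image of the representation is a group \<open>S\<close> of
  2x2 matrices. Scalar matrices stabilize \<open>L\<close>, so the identity is the only scalar in \<open>S\<close>.
  Let \<open>SL\<close> be the subgroup of determinant 1. If it is trivial, the determinant embeds \<open>S\<close> into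
  the cyclic group of units of the field.

  In any case \<open>SL\<close> is abelian. By Cayley-Hamilton \<open>tr(A) A = A\<^sup>2 + 1\<close> on \<open>SL\<close>, where squaring is a
  permutation and \<open>\<Sum>A = 0\<close> unless \<open>SL\<close> is trivial, so \<open>\<Sum>tr(A) A = |SL|\<close>. If two elements did not
  commute, only scalars would commute with \<open>SL\<close>, and Schur orthogonality would give
  \<open>2 \<Sum>tr(A) A = |SL|\<close>, which is absurd as \<open>|SL|\<close> is invertible.

  Fix \<open>Z \<noteq> 1\<close> in \<open>SL\<close>. A conjugate of \<open>Z\<close> under \<open>S\<close> commutes with \<open>Z\<close> and has the same
  characteristic polynomial, so it is \<open>Z\<close> or its inverse. The centralizer of \<open>Z\<close> in \<open>S\<close> embeds into
  the units of an algebraic closure by the ratio of the two eigenvalues, which Frobenius fixes or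
  inverts, so over the field with \<open>q\<close> elements it is cyclic of order dividing \<open>q - 1\<close> or \<open>q + 1\<close>.
  An element \<open>W\<close> outside the centralizer satisfies \<open>W A = adj(A) W\<close> for all \<open>A\<close> in it. Hence \<open>W\<^sup>2\<close>
  equals its adjugate and \<open>A (W A W\<^sup>-\<^sup>1) = det A\<close>; both are scalars of \<open>S\<close>, so \<open>W\<close> is an involution,
  the centralizer is \<open>SL\<close>, and \<open>S\<close> is dihedral.
\<close>

hide_const (open) Divisibility.prime

section \<open>Finite groups\<close>

lemma (in comm_group) ord_mult_coprime:
  assumes x: "x \<in> carrier G" and y: "y \<in> carrier G" and coprime: "coprime (ord x) (ord y)"
  shows "ord (x \<otimes> y) = ord x * ord y"
proof (rule dvd_antisym)
  show "ord (x \<otimes> y) dvd ord x * ord y"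
    by (rule abelian_ord_mul_divides[OF x y])
  have "ord u dvd ord (u \<otimes> v) * ord v" if u: "u \<in> carrier G" and v: "v \<in> carrier G" for u v
  proof -
    let ?n = "ord (u \<otimes> v) * ord v"
    have "u [^] ?n = u [^] ?n \<otimes> v [^] ?n"
      using u v iffD2[OF pow_eq_id[OF v], of ?n] by simp
    also have "\<dots> = (u \<otimes> v) [^] ?n"
      using u v by (simp add: nat_pow_distrib)
    also have "\<dots> = \<one>"
      using u v by (simp only: pow_eq_id m_closed dvd_triv_left)
    finally show ?thesis
      using u by (simp add: pow_eq_id)
  qed
  from this[OF x y] this[OF y x] have "ord x dvd ord (x \<otimes> y)" "ord y dvd ord (x \<otimes> y)"
    using coprime x y by (simp_all add: coprime_dvd_mult_left_iff coprime_commute m_comm)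
  then show "ord x * ord y dvd ord (x \<otimes> y)"
    using coprime by (rule divides_mult)
qed

lemma (in comm_group) ex_ord_greater_if_not_dvd:
  assumes x: "x \<in> carrier G" "ord x > 0" and y: "y \<in> carrier G" "ord y > 0"
    and not_dvd: "\<not> ord y dvd ord x"
  obtains z where "z \<in> carrier G" "ord z > ord x"
proof -
  obtain q where prime: "prime q" and less: "multiplicity q (ord x) < multiplicity q (ord y)"
    using multiplicity_le_imp_dvd[of "ord y" "ord x"] not_dvd y(2) not_le by blast
  define a b where "a = multiplicity q (ord x)" and "b = multiplicity q (ord y)"
  obtain m where ord_x: "ord x = q ^ a * m" "\<not> q dvd m"
    using multiplicity_decompose'[of "ord x" q] x(2) prime
    by (metis a_def gr_implies_not0 not_prime_unit)
  obtain k where ord_y: "ord y = q ^ b * k"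
    using multiplicity_dvd[of q "ord y"] by (auto simp: b_def dvd_def)
  have "q ^ a > 0" "k > 0" "m > 0"
    using prime_gt_0_nat[OF prime] x(2) y(2) ord_y ord_x(1) by simp_all
  then have ords: "ord (x [^] (q ^ a)) = m" "ord (y [^] k) = q ^ b"
    using ord_pow[of x "q ^ a"] ord_pow[of y k] x(1) y(1) ord_y ord_x(1) by auto
  moreover have "coprime m (q ^ b)"
    using prime_imp_coprime[OF prime ord_x(2)] by (simp add: coprime_commute)
  ultimately have "ord (x [^] (q ^ a) \<otimes> y [^] k) = m * q ^ b"
    using ord_mult_coprime[of "x [^] (q ^ a)" "y [^] k"] x(1) y(1) by simp
  also have "\<dots> > m * q ^ a"
    using less prime_gt_1_nat[OF prime] \<open>m > 0\<close> by (simp add: a_def b_def)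
  finally show ?thesis
    using that[of "x [^] (q ^ a) \<otimes> y [^] k"] x(1) y(1) ord_x(1) by (simp add: mult.commute)
qed

lemma (in comm_group) ex_ord_eq_exponent:
  assumes finite: "finite (carrier G)"
  obtains g where "g \<in> carrier G" "\<And>x. x \<in> carrier G \<Longrightarrow> x [^] ord g = \<one>"
proof -
  have "Max (ord ` carrier G) \<in> ord ` carrier G"
    using finite by (intro Max_in) auto
  then obtain g where g: "g \<in> carrier G" "ord g = Max (ord ` carrier G)"
    by (metis imageE)
  then have maximal: "ord z \<le> ord g" if "z \<in> carrier G" for z
    using that finite by simp
  have positive: "ord z > 0" if "z \<in> carrier G" for z
    using ord_ge_1[OF finite that] by simp
  have "ord x dvd ord g" if "x \<in> carrier G" for x
    using ex_ord_greater_if_not_dvd[OF g(1) positive[OF g(1)] that positive[OF that]] maximal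
    by (auto simp flip: not_le)
  then show ?thesis
    using that[OF g(1)] by (simp add: pow_eq_id)
qed

lemma finite_card_roots_of_unity_le:
  assumes "n > 0"
  shows "finite {x::'k::idom. x ^ n = 1} \<and> card {x::'k. x ^ n = 1} \<le> n"
proof -
  let ?P = "monom 1 n - 1 :: 'k poly"
  have "coeff ?P n = 1"
    using assms by simp
  then have nonzero: "?P \<noteq> 0"
    by (metis coeff_0 zero_neq_one)
  have "Polynomial.degree ?P \<le> n"
    by (intro degree_diff_le) (auto simp: degree_monom_le)
  moreover have "{x. poly ?P x = 0} = {x. x ^ n = 1}"
    by (auto simp: poly_monom)
  ultimately show ?thesis
    using poly_roots_finite[OF nonzero] card_poly_roots_bound[OF nonzero] by auto
qed

lemma (in group) cyclic_group_iff_ord_eq_order: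
  assumes finite: "finite (carrier G)"
  shows "cyclic_group G \<longleftrightarrow> (\<exists>g\<in>carrier G. ord g = Coset.order G)"
proof -
  have "carrier G = range (\<lambda>n::int. g [^] n) \<longleftrightarrow> ord g = Coset.order G"
    if g: "g \<in> carrier G" for g
  proof -
    have powers: "generate G {g} = range (\<lambda>n::int. g [^] n)"
      using generate_pow[OF g] by auto
    have "range (\<lambda>n::int. g [^] n) \<subseteq> carrier G"
      using g by auto
    then show ?thesis
      using card_subset_eq[OF finite] by (auto simp: generate_pow_card[OF g] powers Coset.order_def)
  qed
  then show ?thesis
    by (auto simp: cyclic_group)
qed

text \<open>
  An element \<open>g\<close> whose order is the exponent generates, since a field contains at most \<open>ord g\<close>
  roots of unity of that order.
\<close>

lemma (in group) cyclic_group_if_embeds_in_field: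
  fixes f :: "'a \<Rightarrow> 'k::field"
  assumes finite: "finite (carrier G)"
    and mult: "\<And>x y. x \<in> carrier G \<Longrightarrow> y \<in> carrier G \<Longrightarrow> f (x \<otimes> y) = f x * f y"
    and kernel: "\<And>x. x \<in> carrier G \<Longrightarrow> f x = 1 \<Longrightarrow> x = \<one>"
    and power: "\<And>x. x \<in> carrier G \<Longrightarrow> f x ^ e = 1" and "e > 0"
  shows "cyclic_group G" "Coset.order G dvd e"
proof -
  have one: "f \<one> = 1"
    using mult[of \<one> \<one>] power[of \<one>] \<open>e > 0\<close> by (auto simp: power_0_left)
  have inj: "inj_on f (carrier G)"
  proof (rule inj_onI)
    fix x y assume xy: "x \<in> carrier G" "y \<in> carrier G" "f x = f y"
    then have "f (x \<otimes> inv y) = f (y \<otimes> inv y)"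
      by (simp only: mult inv_closed)
    then have "x \<otimes> inv y = \<one>"
      using xy one by (intro kernel) simp_all
    then show "x = y"
      using xy by (metis inv_equality inv_inv inv_closed)
  qed
  have f_pow: "f (x [^] n) = f x ^ n" if "x \<in> carrier G" for x and n :: nat
    using that by (induction n) (auto simp: one mult)
  have "x \<otimes> y = y \<otimes> x" if "x \<in> carrier G" "y \<in> carrier G" for x y
    using that by (intro inj_onD[OF inj]) (auto simp: mult mult.commute)
  then interpret comm_group G
    by (intro group_comm_groupI) auto
  obtain g where g: "g \<in> carrier G" "\<And>x. x \<in> carrier G \<Longrightarrow> x [^] ord g = \<one>"
    using ex_ord_eq_exponent[OF finite] by blast
  have "f ` carrier G \<subseteq> {u. u ^ ord g = 1}"
    using g by (auto simp: one simp flip: f_pow)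
  then have "card (f ` carrier G) \<le> ord g"
    using finite_card_roots_of_unity_le[of "ord g", where 'k = 'k] ord_ge_1[OF finite g(1)]
      card_mono order_trans by (metis One_nat_def Suc_le_eq)
  then have ord_g: "ord g = Coset.order G"
    using ord_le_group_order[OF finite g(1)] by (simp add: card_image[OF inj] Coset.order_def)
  then show "cyclic_group G"
    using g(1) by (auto simp: cyclic_group_iff_ord_eq_order[OF finite])
  have "g [^] e = \<one>"
    using g(1) power by (intro kernel) (simp_all add: f_pow)
  then show "Coset.order G dvd e"
    using g(1) ord_g by (simp add: pow_eq_id)
qed

theorem (in group) cauchy_ord:
  assumes finite: "finite (carrier G)" and prime: "prime q" and dvd: "q dvd Coset.order G"
  obtains x where "x \<in> carrier G" "ord x = q"
proof -
  obtain m where "Coset.order G = q ^ 1 * m"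
    using dvd by auto
  then obtain K where K: "subgroup K G" "card K = q"
    using sylow_thm[OF prime group_axioms _ finite, of 1 m] by auto
  then have "K \<noteq> {\<one>}"
    using prime_gt_1_nat[OF prime] by auto
  then obtain x where x: "x \<in> K" "x \<noteq> \<one>"
    using subgroup.one_closed[OF K(1)] by blast
  then have carrier: "x \<in> carrier G"
    using subgroup.mem_carrier[OF K(1)] by blast
  interpret K: group "G\<lparr>carrier := K\<rparr>"
    by (rule subgroup.subgroup_is_group[OF K(1) group_axioms])
  have "x [^] q = \<one>"
    using K.pow_order_eq_1[of x] x(1) K(2) by (simp add: Coset.order_def flip: nat_pow_consistent)
  then have "ord x dvd q"
    using carrier by (simp add: pow_eq_id)
  moreover have "ord x \<noteq> 1"
    using carrier x(2) ord_eq_1 by blast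
  ultimately show ?thesis
    using that carrier prime by (auto simp: prime_nat_iff)
qed

lemma (in group) cyclic_subgroup_generator:
  assumes C: "subgroup C G" and cyclic: "cyclic_group (G\<lparr>carrier := C\<rparr>)"
  obtains r where "r \<in> C" "C = generate G {r}"
proof -
  interpret C: group "G\<lparr>carrier := C\<rparr>"
    by (rule subgroup.subgroup_is_group[OF C group_axioms])
  obtain r where r: "r \<in> C" "C = range (\<lambda>n::int. r [^]\<^bsub>G\<lparr>carrier := C\<rparr>\<^esub> n)"
    using cyclic by (auto simp: C.cyclic_group)
  then have "C = generate G {r}"
    using generate_pow[of r] subgroup.mem_carrier[OF C] int_pow_consistent[OF C] by auto
  then show ?thesis
    using that r(1) by blast
qed

lemma (in group) inj_on_int_pow:
  assumes "g \<in> carrier G"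
  shows "inj_on (\<lambda>n::int. g [^] n) {0..<int (ord g)}"
proof (rule inj_onI)
  fix m n :: int
  assume mn: "m \<in> {0..<int (ord g)}" "n \<in> {0..<int (ord g)}" and "g [^] m = g [^] n"
  then have "n mod int (ord g) = m mod int (ord g)"
    using assms by (simp only: int_pow_eq mod_eq_dvd_iff)
  then show "m = n"
    using mn by simp
qed

lemma (in group) int_pow_mod_ord:
  "g \<in> carrier G \<Longrightarrow> g [^] (n mod int (ord g)) = g [^] (n::int)"
  by (simp add: int_pow_eq)

lemma (in group) iso_integer_mod_group:
  assumes finite: "finite (carrier G)" and cyclic: "cyclic_group G"
  shows "G \<cong> integer_mod_group (Coset.order G)"
proof -
  let ?Z = "integer_mod_group (Coset.order G)"
  obtain g where g: "g \<in> carrier G" "ord g = Coset.order G"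
    using cyclic cyclic_group_iff_ord_eq_order[OF finite] by blast
  have carrier: "carrier ?Z = {0..<int (ord g)}"
    using finite order_gt_0_iff_finite by (auto simp: carrier_integer_mod_group g(2))
  let ?h = "\<lambda>n::int. g [^] n"
  have "?h \<in> hom ?Z G"
    using g(1) int_pow_mod_ord[OF g(1)] by (auto simp: hom_def int_pow_mult g(2))
  moreover have inj: "inj_on ?h (carrier ?Z)"
    unfolding carrier by (rule inj_on_int_pow[OF g(1)])
  moreover have "card (?h ` carrier ?Z) = card (carrier G)"
    using card_image[OF inj] unfolding carrier g(2) by (simp add: Coset.order_def)
  then have "?h ` carrier ?Z = carrier G"
    using g(1) by (intro card_subset_eq[OF finite]) auto
  ultimately have "?h \<in> iso ?Z G"
    by (simp add: iso_def bij_betw_def)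
  then show ?thesis
    using group.iso_sym[OF group_integer_mod_group] is_isoI by blast
qed

lemma (in group) inverting_involution_int_pow:
  assumes r: "r \<in> carrier G" and w: "w \<in> carrier G"
    and involution: "w \<otimes> w = \<one>" and inverts: "w \<otimes> r \<otimes> w = inv r"
  shows "w \<otimes> r [^] (n::int) = inv (r [^] n) \<otimes> w"
proof -
  have cancel: "w \<otimes> (w \<otimes> x) = x" if "x \<in> carrier G" for x
    using w that involution by (simp flip: m_assoc)
  have "(\<lambda>x. w \<otimes> x \<otimes> w) \<in> hom G G"
    using w by (auto intro!: homI simp: m_assoc cancel)
  from hom_int_pow[OF this r is_group is_group, of n]
  have "w \<otimes> r [^] n \<otimes> w = inv (r [^] n)"
    using r by (simp add: inverts int_pow_inv)
  then have "inv (r [^] n) \<otimes> w = w \<otimes> r [^] n \<otimes> w \<otimes> w"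
    by simp
  then show ?thesis
    using w r involution by (simp add: m_assoc)
qed

lemma (in group) hom_dihedral_group:
  assumes r: "r \<in> carrier G" and w: "w \<in> carrier G"
    and involution: "w \<otimes> w = \<one>" and inverts: "w \<otimes> r \<otimes> w = inv r"
  shows "(\<lambda>(n::int, x). r [^] n \<otimes> (if x then w else \<one>)) \<in> hom (dihedral_group (ord r)) G"
    (is "?h \<in> _")
proof (rule homI)
  fix u assume "u \<in> carrier (dihedral_group (ord r))"
  then show "?h u \<in> carrier G"
    using r w by (auto split: prod.split)
next
  fix u v :: "int \<times> bool"
  obtain m x n y where uv: "u = (m, x)" "v = (n, y)"
    by fastforce
  have "r [^] m \<otimes> w \<otimes> r [^] n = r [^] m \<otimes> (inv (r [^] n) \<otimes> w)"
    using r w inverting_involution_int_pow[OF assms] by (simp add: m_assoc)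
  also have "\<dots> = r [^] (m - n) \<otimes> w"
    using r w by (simp add: int_pow_diff m_assoc)
  finally have swap: "r [^] m \<otimes> w \<otimes> r [^] n = r [^] (m - n) \<otimes> w" .
  have "r [^] m \<otimes> w \<otimes> (r [^] n \<otimes> w) = r [^] m \<otimes> w \<otimes> r [^] n \<otimes> w"
    using r w by (simp add: m_assoc)
  also have "\<dots> = r [^] (m - n)"
    using r w by (simp add: swap) (simp add: m_assoc involution)
  finally show "?h (u \<otimes>\<^bsub>dihedral_group (ord r)\<^esub> v) = ?h u \<otimes> ?h v"
    using r w swap
    by (auto simp: uv dihedral_group_def int_pow_mod_ord int_pow_mult m_assoc)
qed

lemma (in group) iso_dihedral_group:
  assumes finite: "finite (carrier G)" and r: "r \<in> carrier G" and w: "w \<in> carrier G"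
    and involution: "w \<otimes> w = \<one>" and inverts: "w \<otimes> r \<otimes> w = inv r"
    and not_power: "w \<notin> generate G {r}" and index: "Coset.order G = 2 * ord r"
  shows "G \<cong> dihedral_group (ord r)"
proof -
  let ?D = "dihedral_group (ord r)"
  let ?h = "\<lambda>(n::int, x). r [^] n \<otimes> (if x then w else \<one>)"
  have hom: "?h \<in> hom ?D G"
    by (rule hom_dihedral_group[OF r w involution inverts])
  have "r [^] m \<otimes> w \<noteq> r [^] n" for m n :: int
  proof
    assume "r [^] m \<otimes> w = r [^] n"
    then have "w = inv (r [^] m) \<otimes> r [^] n"
      using r w by (metis int_pow_closed inv_solve_left)
    also have "\<dots> = r [^] (- m + n)"
      using r by (simp only: int_pow_mult int_pow_neg)
    finally show False
      using not_power generate_pow[OF r] by blast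
  qed
  then have "x = y \<and> r [^] m = r [^] n" if "?h (m, x) = ?h (n, y)" for m n :: int and x y
    using that r w by (cases x; cases y) (auto dest: sym)
  then have inj: "inj_on ?h (carrier ?D)"
    using inj_onD[OF inj_on_int_pow[OF r]] by (auto intro!: inj_onI simp: dihedral_group_def)
  have "?h ` carrier ?D \<subseteq> carrier G"
    using hom by (rule hom_carrier)
  moreover have "card (?h ` carrier ?D) = card (carrier G)"
    using card_image[OF inj] order_dihedral_group[of "ord r"] index by (simp add: Coset.order_def)
  ultimately have "?h \<in> iso ?D G"
    using card_subset_eq[OF finite] hom inj by (auto simp: iso_def bij_betw_def)
  moreover have "ord r > 0"
    using ord_ge_1[OF finite r] by simp
  ultimately show ?thesis
    using group.iso_sym[OF group_dihedral_group] is_isoI by blast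
qed

lemma (in group_hom) card_image_dvd_order: "card (h ` carrier G) dvd Coset.order G"
proof -
  let ?I = "H\<lparr>carrier := h ` carrier G\<rparr>"
  interpret I: group_hom G ?I h
    using homh
    by (intro group_hom.intro group_hom_axioms.intro G.is_group
        subgroup.subgroup_is_group[OF img_is_subgroup H.is_group]) (auto simp: hom_def)
  have "card (h ` carrier G) = card (rcosets\<^bsub>G\<^esub> kernel G ?I h)"
    using iso_same_card[OF I.FactGroup_iso] by (simp add: FactGroup_def)
  then show ?thesis
    using G.lagrange[OF I.subgroup_kernel] by (metis dvd_triv_left)
qed

definition mult_monoid :: "'a::monoid_mult set \<Rightarrow> 'a monoid" where
  "mult_monoid A = \<lparr>carrier = A, monoid.mult = (*), one = 1\<rparr>"

lemma mult_monoid_sel [simp]: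
  "carrier (mult_monoid A) = A" "x \<otimes>\<^bsub>mult_monoid A\<^esub> y = x * y" "\<one>\<^bsub>mult_monoid A\<^esub> = 1"
  "(mult_monoid A)\<lparr>carrier := B\<rparr> = mult_monoid B" "Coset.order (mult_monoid A) = card A"
  by (simp_all add: mult_monoid_def Coset.order_def)

lemma mult_monoid_pow [simp]: "x [^]\<^bsub>mult_monoid A\<^esub> (n::nat) = x ^ n"
  by (induction n) (simp_all add: nat_pow_def mult_monoid_def power_commutes)

section \<open>Finite fields\<close>

lemma power_minus_1_eq_1:
  fixes x :: "'a::idom"
  assumes "x ^ n = x" "x \<noteq> 0" "n > 0"
  shows "x ^ (n - 1) = 1"
  using assms by (simp add: power_eq_if)

lemma CARD_finite_field_gt_1: "CARD('k::finite_field) > 1"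
  using card_mono[of UNIV "{0, 1::'k}"] by simp

lemma CARD_finite_field_eq_CHAR_power:
  "\<exists>n. CARD('k::finite_field) = CHAR('k) ^ n"
proof -
  let ?A = "\<lparr>carrier = UNIV, monoid.mult = (+), one = 0\<rparr> :: 'k monoid"
  interpret A: group ?A
    by (rule groupI) (auto simp: add.assoc intro: exI[of _ "- x" for x])
  have pow: "x [^]\<^bsub>?A\<^esub> n = of_nat n * x" for x :: 'k and n :: nat
    by (induction n) (simp_all add: algebra_simps)
  have prime_dvd: "q = CHAR('k)" if q: "prime q" "q dvd CARD('k)" for q
  proof -
    obtain x where "A.ord x = q"
      using A.cauchy_ord[of q] q by (auto simp: Coset.order_def)
    then have "q dvd CHAR('k)"
      using A.pow_eq_id[of x "CHAR('k)"] by (simp add: pow)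
    then show ?thesis
      using q(1) CHAR_prime[where 'a = 'k] primes_dvd_imp_eq by blast
  qed
  obtain m where decomposition: "CARD('k) = CHAR('k) ^ multiplicity CHAR('k) CARD('k) * m"
    "\<not> CHAR('k) dvd m"
    using multiplicity_decompose'[of "CARD('k)" "CHAR('k)"] CHAR_prime[where 'a = 'k]
    by (metis finite_UNIV_card_ge_0 finite less_irrefl not_prime_unit)
  then have "m = 1"
    using prime_dvd prime_factor_nat[of m] by (metis dvd_triv_right dvd_trans)
  then show ?thesis
    using decomposition(1) by (metis mult_1_right)
qed

lemma to_ac_power_CARD: "to_ac (a::'k::finite_field) ^ CARD('k) = to_ac a"
  by (simp add: finite_field_power_card_eq_same flip: to_ac_power)

lemma alg_closure_add_power_CARD:
  "(x + y :: 'k::finite_field alg_closure) ^ CARD('k) = x ^ CARD('k) + y ^ CARD('k)"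
proof -
  obtain n where "CARD('k) = CHAR('k alg_closure) ^ n"
    using CARD_finite_field_eq_CHAR_power[where 'k = 'k] by auto
  moreover have "prime CHAR('k alg_closure)"
    using CHAR_prime[where 'a = 'k] by simp
  ultimately show ?thesis
    using freshmans_dream' by blast
qed

section \<open>Two by two matrices\<close>

datatype 'k mat2 = Mat2 (mat11: 'k) (mat12: 'k) (mat21: 'k) (mat22: 'k)

instantiation mat2 :: (comm_ring_1) ring_1
begin

definition zero_mat2 :: "'a mat2" where "0 = Mat2 0 0 0 0"

definition one_mat2 :: "'a mat2" where "1 = Mat2 1 0 0 1"

definition plus_mat2 :: "'a mat2 \<Rightarrow> 'a mat2 \<Rightarrow> 'a mat2" where
  "A + B = Mat2 (mat11 A + mat11 B) (mat12 A + mat12 B) (mat21 A + mat21 B) (mat22 A + mat22 B)"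

definition minus_mat2 :: "'a mat2 \<Rightarrow> 'a mat2 \<Rightarrow> 'a mat2" where
  "A - B = Mat2 (mat11 A - mat11 B) (mat12 A - mat12 B) (mat21 A - mat21 B) (mat22 A - mat22 B)"

definition uminus_mat2 :: "'a mat2 \<Rightarrow> 'a mat2" where
  "- A = Mat2 (- mat11 A) (- mat12 A) (- mat21 A) (- mat22 A)"

definition times_mat2 :: "'a mat2 \<Rightarrow> 'a mat2 \<Rightarrow> 'a mat2" where
  "A * B = Mat2 (mat11 A * mat11 B + mat12 A * mat21 B) (mat11 A * mat12 B + mat12 A * mat22 B)
     (mat21 A * mat11 B + mat22 A * mat21 B) (mat21 A * mat12 B + mat22 A * mat22 B)"

lemmas mat2_ops = zero_mat2_def one_mat2_def plus_mat2_def minus_mat2_def uminus_mat2_def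
  times_mat2_def

instance
  by standard (simp_all add: mat2_ops algebra_simps)

end

lemma mat2_eq_iff:
  "A = B \<longleftrightarrow> mat11 A = mat11 B \<and> mat12 A = mat12 B \<and> mat21 A = mat21 B \<and> mat22 A = mat22 B"
  by (auto intro: mat2.expand)

definition scalar_mat2 :: "'a::comm_ring_1 \<Rightarrow> 'a mat2" where
  "scalar_mat2 c = Mat2 c 0 0 c"

definition mat2_tr :: "'a::comm_ring_1 mat2 \<Rightarrow> 'a" where
  "mat2_tr A = mat11 A + mat22 A"

definition mat2_det :: "'a::comm_ring_1 mat2 \<Rightarrow> 'a" where
  "mat2_det A = mat11 A * mat22 A - mat12 A * mat21 A"

definition mat2_adj :: "'a::comm_ring_1 mat2 \<Rightarrow> 'a mat2" where
  "mat2_adj A = Mat2 (mat22 A) (- mat12 A) (- mat21 A) (mat11 A)"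

definition mat2_discr :: "'a::comm_ring_1 mat2 \<Rightarrow> 'a" where
  "mat2_discr A = mat2_tr A ^ 2 - 4 * mat2_det A"

lemmas mat2_defs = mat2_eq_iff mat2_ops scalar_mat2_def mat2_tr_def mat2_det_def mat2_adj_def

lemma scalar_mat2_0 [simp]: "scalar_mat2 0 = 0"
  and scalar_mat2_1 [simp]: "scalar_mat2 1 = 1"
  and scalar_mat2_eq_iff [simp]: "scalar_mat2 a = scalar_mat2 b \<longleftrightarrow> a = b"
  and scalar_mat2_mult: "scalar_mat2 a * scalar_mat2 b = scalar_mat2 (a * b)"
  and scalar_mat2_commute: "scalar_mat2 a * A = A * scalar_mat2 a"
  and scalar_mat2_add: "scalar_mat2 (a + b) = scalar_mat2 a + scalar_mat2 b"
  and mat2_det_scalar [simp]: "mat2_det (scalar_mat2 a) = a ^ 2"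
  by (auto simp: mat2_defs mult.commute power2_eq_square)

lemma scalar_mat2_of_nat: "scalar_mat2 (of_nat n) = of_nat n"
  by (induction n) (simp_all add: scalar_mat2_add)

lemma range_scalar_mat2_iff:
  "A \<in> range scalar_mat2 \<longleftrightarrow> mat11 A = mat22 A \<and> mat12 A = 0 \<and> mat21 A = 0"
  by (auto simp: mat2_defs)

lemma mat2_det_1 [simp]: "mat2_det 1 = 1"
  and mat2_det_mult: "mat2_det (A * B) = mat2_det A * mat2_det B"
  and mat2_det_diff_1: "mat2_det (A - 1) = mat2_det A - mat2_tr A + 1"
  and mat2_tr_diff: "mat2_tr (A - B) = mat2_tr A - mat2_tr B"
  and mat2_tr_mult_commute: "mat2_tr (A * B) = mat2_tr (B * A)"
  and mat2_tr_square: "mat2_tr (A * A) = mat2_tr A ^ 2 - 2 * mat2_det A"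
  by (simp_all add: mat2_defs algebra_simps power2_eq_square)

lemma mat2_tr_sum: "mat2_tr (sum f I) = (\<Sum>i\<in>I. mat2_tr (f i))"
  by (induction I rule: infinite_finite_induct) (simp_all add: mat2_defs algebra_simps)

lemma mat2_adj_mult: "mat2_adj (A * B) = mat2_adj B * mat2_adj A"
  and mult_mat2_adj: "A * mat2_adj A = scalar_mat2 (mat2_det A)"
  and mat2_adj_mult_self: "mat2_adj A * A = scalar_mat2 (mat2_det A)"
  and mat2_adj_eq_tr_minus: "mat2_adj A = scalar_mat2 (mat2_tr A) - A"
  and mat2_tr_adj [simp]: "mat2_tr (mat2_adj A) = mat2_tr A"
  by (simp_all add: mat2_defs algebra_simps)

lemma mat2_cayley_hamilton:
  "A * A = scalar_mat2 (mat2_tr A) * A - scalar_mat2 (mat2_det A)"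
  by (simp add: mat2_defs algebra_simps)

lemma mat2_tr_affine: "mat2_tr (scalar_mat2 a + scalar_mat2 b * A) = 2 * a + b * mat2_tr A"
  and mat2_det_affine: "mat2_det (scalar_mat2 a + scalar_mat2 b * A) =
    a ^ 2 + a * b * mat2_tr A + b ^ 2 * mat2_det A"
  and mat2_discr_affine: "mat2_discr (scalar_mat2 a + scalar_mat2 b * A) = b ^ 2 * mat2_discr A"
  and mat2_adj_affine: "mat2_adj (scalar_mat2 a + scalar_mat2 b * A) =
    scalar_mat2 a + scalar_mat2 b * mat2_adj A"
  and mat2_mult_affine: "(scalar_mat2 a + scalar_mat2 b * A) * (scalar_mat2 c + scalar_mat2 d * A) =
    scalar_mat2 (a * c - b * d * mat2_det A) + scalar_mat2 (a * d + b * c + b * d * mat2_tr A) * A"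
  by (simp_all add: mat2_discr_def mat2_defs algebra_simps power2_eq_square)

lemma mat2_mult_eq_0_cancel:
  fixes A :: "'a::field mat2"
  assumes "A * B = 0" and "mat2_det A \<noteq> 0"
  shows "B = 0"
proof -
  have "scalar_mat2 (mat2_det A) * B = mat2_adj A * (A * B)"
    by (simp add: mat2_adj_mult_self flip: mult.assoc)
  then have "scalar_mat2 (mat2_det A) * B = 0"
    using assms(1) by simp
  then show ?thesis
    using assms(2) by (simp add: mat2_defs)
qed

lemma mat2_discr_nonzero_imp_nonscalar: "mat2_discr Z \<noteq> 0 \<Longrightarrow> Z \<notin> range scalar_mat2"
  by (auto simp: mat2_discr_def mat2_defs algebra_simps power2_eq_square)

lemma commute_nonscalar_mat2:
  fixes A M :: "'a::field mat2"
  assumes commute: "A * M = M * A" and nonscalar: "M \<notin> range scalar_mat2"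
  obtains a b where "A = scalar_mat2 a + scalar_mat2 b * M"
proof -
  have minors: "mat12 A * mat21 M = mat21 A * mat12 M"
    "mat12 A * (mat11 M - mat22 M) = (mat11 A - mat22 A) * mat12 M"
    "mat21 A * (mat11 M - mat22 M) = (mat11 A - mat22 A) * mat21 M"
    using arg_cong[OF commute, of mat11] arg_cong[OF commute, of mat12]
      arg_cong[OF commute, of mat21]
    by (simp_all add: times_mat2_def algebra_simps)
  obtain b where proportional: "mat12 A = b * mat12 M" "mat21 A = b * mat21 M"
    "mat11 A - mat22 A = b * (mat11 M - mat22 M)"
  proof -
    consider (upper) "mat12 M \<noteq> 0" | (lower) "mat21 M \<noteq> 0" | (diagonal) "mat11 M - mat22 M \<noteq> 0"
      using nonscalar by (auto simp: range_scalar_mat2_iff)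
    then show ?thesis
    proof cases
      case upper
      then show ?thesis
        using minors
        by (intro that[of "mat12 A / mat12 M"])
          (simp_all add: divide_simps mult.commute)
    next
      case lower
      then show ?thesis
        using minors
        by (intro that[of "mat21 A / mat21 M"])
          (simp_all add: divide_simps mult.commute)
    next
      case diagonal
      then show ?thesis
        using minors
        by (intro that[of "(mat11 A - mat22 A) / (mat11 M - mat22 M)"])
          (simp_all add: nonzero_eq_divide_eq mult.commute)
    qed
  qed
  have "A = scalar_mat2 (mat11 A - b * mat11 M) + scalar_mat2 b * M"
    using proportional by (simp add: mat2_defs algebra_simps)
  then show ?thesis
    by (rule that)
qed

lemma commute_nonscalar_mat2_trans:
  fixes A B M :: "'a::field mat2"
  assumes "A * M = M * A" "B * M = M * B" and nonscalar: "M \<notin> range scalar_mat2"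
  shows "A * B = B * A"
proof -
  obtain a b where affine_A: "A = scalar_mat2 a + scalar_mat2 b * M"
    using commute_nonscalar_mat2[OF assms(1) nonscalar] .
  obtain c d where affine_B: "B = scalar_mat2 c + scalar_mat2 d * M"
    using commute_nonscalar_mat2[OF assms(2) nonscalar] .
  show ?thesis
    unfolding affine_A affine_B mat2_mult_affine by (simp add: algebra_simps)
qed

lemma mat2_adj_intertwines_commutant:
  fixes A W Z :: "'a::field mat2"
  assumes intertwines: "W * Z = mat2_adj Z * W" and commute: "A * Z = Z * A"
    and nonscalar: "Z \<notin> range scalar_mat2"
  shows "W * A = mat2_adj A * W"
proof -
  obtain a b where affine: "A = scalar_mat2 a + scalar_mat2 b * Z"
    using commute_nonscalar_mat2[OF commute nonscalar] .
  have "W * A = scalar_mat2 a * W + scalar_mat2 b * (W * Z)"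
    unfolding affine by (simp add: distrib_left scalar_mat2_commute mult.assoc)
  also have "\<dots> = (scalar_mat2 a + scalar_mat2 b * mat2_adj Z) * W"
    by (simp add: intertwines distrib_right mult.assoc)
  finally show ?thesis
    by (simp add: affine mat2_adj_affine)
qed

lemma self_adjugate_mat2_scalar:
  fixes A :: "'a::field mat2"
  assumes "mat2_adj A = A" and "(2::'a) \<noteq> 0"
  shows "A \<in> range scalar_mat2"
proof -
  have neg_eq: "c = 0" if "- c = c" for c :: 'a
    using assms(2) that by (metis add.right_inverse mult_2 mult_eq_0_iff)
  have "mat22 A = mat11 A" "- mat12 A = mat12 A" "- mat21 A = mat21 A"
    using arg_cong[OF assms(1), of mat11] arg_cong[OF assms(1), of mat12]
      arg_cong[OF assms(1), of mat21]
    by (simp_all add: mat2_adj_def)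
  then show ?thesis
    by (simp add: range_scalar_mat2_iff neg_eq)
qed

lemma commutant_mat2_reduced:
  fixes E Z :: "'a::field mat2"
  assumes "E * Z = Z * E" and discr: "mat2_discr Z \<noteq> 0" and tr_det: "mat2_tr E = 0" "mat2_det E = 0"
  shows "E = 0"
proof -
  obtain a b where affine: "E = scalar_mat2 a + scalar_mat2 b * Z"
    using commute_nonscalar_mat2[OF assms(1) mat2_discr_nonzero_imp_nonscalar[OF discr]] .
  have "mat2_discr E = 0"
    by (simp add: mat2_discr_def tr_det)
  then have "b = 0"
    using discr by (simp add: affine mat2_discr_affine)
  then show ?thesis
    using tr_det(2) by (simp add: affine)
qed

text \<open>By Cayley-Hamilton \<open>(Y - Z) (Y - adj Z) = 0\<close>, and both factors have trace zero.\<close>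

lemma commuting_mat2_same_charpoly:
  fixes Y Z :: "'a::field mat2"
  assumes commute: "Y * Z = Z * Y" and discr: "mat2_discr Z \<noteq> 0"
    and tr: "mat2_tr Y = mat2_tr Z" and det: "mat2_det Y = mat2_det Z"
  shows "Y = Z \<or> Y = mat2_adj Z"
proof -
  have adj: "Y * mat2_adj Z = scalar_mat2 (mat2_tr Z) * Y - Z * Y"
    by (simp add: mat2_adj_eq_tr_minus algebra_simps commute scalar_mat2_commute)
  have "(Y - Z) * (Y - mat2_adj Z) = Y * Y - Y * mat2_adj Z - Z * Y + Z * mat2_adj Z"
    by (simp add: algebra_simps)
  also have "\<dots> = 0"
    unfolding adj mat2_cayley_hamilton[of Y] mult_mat2_adj by (simp add: tr det)
  finally have "mat2_det (Y - Z) * mat2_det (Y - mat2_adj Z) = 0"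
    by (metis mat2_det_mult mat2_det_scalar scalar_mat2_0 zero_power2)
  moreover have "(Y - Z) * Z = Z * (Y - Z)" "(Y - mat2_adj Z) * Z = Z * (Y - mat2_adj Z)"
    by (simp_all add: algebra_simps commute mult_mat2_adj mat2_adj_mult_self)
  note this[THEN commutant_mat2_reduced[OF _ discr]]
  ultimately show ?thesis
    by (auto simp: mat2_tr_diff tr)
qed

lemma mat2_sum_matrix_units:
  "A * Mat2 1 0 0 0 * B * Mat2 1 0 0 0 + A * Mat2 0 1 0 0 * B * Mat2 0 0 1 0 +
   A * Mat2 0 0 1 0 * B * Mat2 0 1 0 0 + A * Mat2 0 0 0 1 * B * Mat2 0 0 0 1 =
   scalar_mat2 (mat2_tr B) * A"
  by (simp add: mat2_defs algebra_simps)

section \<open>Eigenvalue characters\<close>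

text \<open>
  For a root \<open>l\<close> of the characteristic polynomial of \<open>Z\<close>, this is the character of the algebra
  \<open>k[Z]\<close> that maps \<open>a + b Z\<close> to \<open>a + b l\<close>.
\<close>

definition eigenvalue_char :: "'k::field mat2 \<Rightarrow> 'k alg_closure \<Rightarrow> 'k mat2 \<Rightarrow> 'k alg_closure" where
  "eigenvalue_char Z l A =
     (to_ac (mat2_tr (A * Z)) - (to_ac (mat2_tr Z) - l) * to_ac (mat2_tr A)) /
     (2 * l - to_ac (mat2_tr Z))"

locale mat2_eigenvalue =
  fixes Z :: "'k::field mat2" and l :: "'k alg_closure"
  assumes root: "l ^ 2 = to_ac (mat2_tr Z) * l - to_ac (mat2_det Z)"
    and discr: "mat2_discr Z \<noteq> 0"
begin

abbreviation conjugate :: "'k alg_closure" where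
  "conjugate \<equiv> to_ac (mat2_tr Z) - l"

lemma conjugate_eigenvalue: "mat2_eigenvalue Z conjugate"
  using root discr by unfold_locales (simp_all add: algebra_simps power2_eq_square)

lemma mult_conjugate: "l * conjugate = to_ac (mat2_det Z)"
  using root by (simp add: algebra_simps power2_eq_square)

lemma neq_conjugate: "l \<noteq> conjugate"
proof
  assume "l = conjugate"
  then have "2 * l = to_ac (mat2_tr Z)"
    by (simp add: algebra_simps)
  then have "to_ac (mat2_discr Z) = (2 * l) ^ 2 - 4 * (l * conjugate)"
    by (simp add: mat2_discr_def mult_conjugate)
  also have "\<dots> = 0"
    by (simp add: power2_eq_square flip: \<open>l = conjugate\<close>)
  finally show False
    using discr by simp
qed

lemma eigenvalue_char_affine:
  "eigenvalue_char Z l (scalar_mat2 a + scalar_mat2 b * Z) = to_ac a + to_ac b * l"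
proof -
  let ?t = "to_ac (mat2_tr Z)" and ?A = "scalar_mat2 a + scalar_mat2 b * Z"
  have tr: "mat2_tr (?A * Z) = a * mat2_tr Z + b * (mat2_tr Z ^ 2 - 2 * mat2_det Z)"
    by (simp add: mat2_defs algebra_simps power2_eq_square)
  have "(to_ac a + to_ac b * l) * (2 * l - ?t) =
      to_ac a * (2 * l - ?t) + to_ac b * (2 * l ^ 2 - ?t * l)"
    by (simp add: algebra_simps power2_eq_square)
  also have "\<dots> = to_ac (mat2_tr (?A * Z)) - conjugate * to_ac (mat2_tr ?A)"
    unfolding root tr mat2_tr_affine by (simp add: algebra_simps power2_eq_square)
  finally have "to_ac (mat2_tr (?A * Z)) - conjugate * to_ac (mat2_tr ?A) =
      (to_ac a + to_ac b * l) * (2 * l - ?t)" ..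
  moreover have "2 * l - ?t \<noteq> 0"
    using neq_conjugate by (simp add: algebra_simps)
  ultimately show ?thesis
    by (simp add: eigenvalue_char_def)
qed

lemma commutant_affine:
  assumes "A * Z = Z * A"
  obtains a b where "A = scalar_mat2 a + scalar_mat2 b * Z"
  using commute_nonscalar_mat2[OF assms mat2_discr_nonzero_imp_nonscalar[OF discr]] .

lemma eigenvalue_char_mult:
  assumes "A * Z = Z * A" "B * Z = Z * B"
  shows "eigenvalue_char Z l (A * B) = eigenvalue_char Z l A * eigenvalue_char Z l B"
proof -
  obtain a b c d where
    affine: "A = scalar_mat2 a + scalar_mat2 b * Z" "B = scalar_mat2 c + scalar_mat2 d * Z"
    using assms commutant_affine by metis
  have "eigenvalue_char Z l A * eigenvalue_char Z l B =
      to_ac (a * c) + to_ac (a * d + b * c) * l + to_ac (b * d) * l ^ 2"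
    unfolding affine eigenvalue_char_affine by (simp add: algebra_simps power2_eq_square)
  also have "\<dots> = eigenvalue_char Z l (A * B)"
    unfolding affine mat2_mult_affine eigenvalue_char_affine root by (simp add: algebra_simps)
  finally show ?thesis ..
qed

lemma eigenvalue_char_1: "eigenvalue_char Z l 1 = 1"
  using eigenvalue_char_affine[of 1 0] by simp

lemma eigenvalue_char_conjugate_mult:
  assumes "A * Z = Z * A"
  shows "eigenvalue_char Z l A * eigenvalue_char Z conjugate A = to_ac (mat2_det A)"
proof -
  interpret conj: mat2_eigenvalue Z conjugate
    by (rule conjugate_eigenvalue)
  obtain a b where affine: "A = scalar_mat2 a + scalar_mat2 b * Z"
    using assms commutant_affine by blast
  have "eigenvalue_char Z l A * eigenvalue_char Z conjugate A =
      to_ac (a ^ 2 + a * b * mat2_tr Z) + to_ac (b ^ 2) * (l * conjugate)"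
    unfolding affine eigenvalue_char_affine conj.eigenvalue_char_affine
    by (simp add: algebra_simps power2_eq_square)
  then show ?thesis
    unfolding mult_conjugate affine mat2_det_affine by simp
qed

definition eigenvalue_ratio :: "'k mat2 \<Rightarrow> 'k alg_closure" where
  "eigenvalue_ratio A = eigenvalue_char Z l A / eigenvalue_char Z conjugate A"

lemma eigenvalue_ratio_mult:
  assumes "A * Z = Z * A" "B * Z = Z * B"
  shows "eigenvalue_ratio (A * B) = eigenvalue_ratio A * eigenvalue_ratio B"
  using eigenvalue_char_mult[OF assms]
    mat2_eigenvalue.eigenvalue_char_mult[OF conjugate_eigenvalue assms]
  by (simp add: eigenvalue_ratio_def)

lemma eigenvalue_char_eq_conjugate_imp_scalar:
  assumes "A * Z = Z * A" "eigenvalue_char Z l A = eigenvalue_char Z conjugate A"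
  shows "A \<in> range scalar_mat2"
proof -
  interpret conj: mat2_eigenvalue Z conjugate
    by (rule conjugate_eigenvalue)
  obtain a b where affine: "A = scalar_mat2 a + scalar_mat2 b * Z"
    using assms(1) commutant_affine by blast
  have "to_ac b * (l - conjugate) = 0"
    using assms(2) unfolding affine eigenvalue_char_affine conj.eigenvalue_char_affine
    by (simp add: algebra_simps)
  then have "b = 0"
    using neq_conjugate by simp
  then show ?thesis
    by (simp add: affine)
qed

end

lemma ex_mat2_eigenvalue:
  assumes "mat2_discr Z \<noteq> 0"
  obtains l where "mat2_eigenvalue Z l"
proof -
  let ?P = "[:to_ac (mat2_det Z), - to_ac (mat2_tr Z), 1:]"
  obtain l where "poly ?P l = 0"
    using alg_closed_imp_poly_has_root[of ?P] by auto
  then have "l ^ 2 = to_ac (mat2_tr Z) * l - to_ac (mat2_det Z)"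
    by (simp add: algebra_simps power2_eq_square)
  then show ?thesis
    using that assms by (simp add: mat2_eigenvalue_def)
qed

locale finite_field_mat2_eigenvalue = mat2_eigenvalue Z l
  for Z :: "'k::finite_field mat2" and l
begin

lemma conjugate_power_CARD: "conjugate ^ CARD('k) = to_ac (mat2_tr Z) - l ^ CARD('k)"
  using alg_closure_add_power_CARD[of conjugate l] by (simp add: to_ac_power_CARD algebra_simps)

lemma frobenius_cases: "l ^ CARD('k) = l \<or> l ^ CARD('k) = conjugate"
proof -
  let ?f = "l ^ CARD('k)"
  have "?f * (to_ac (mat2_tr Z) - ?f) = to_ac (mat2_det Z)"
    unfolding conjugate_power_CARD[symmetric]
    by (simp add: mult_conjugate to_ac_power_CARD flip: power_mult_distrib)
  then have "(?f - l) * (?f - conjugate) = 0"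
    using mult_conjugate by (simp add: algebra_simps)
  then show ?thesis
    by auto
qed

lemma eigenvalue_char_power_CARD:
  assumes "A * Z = Z * A" "mat2_eigenvalue Z (l ^ CARD('k))"
  shows "eigenvalue_char Z l A ^ CARD('k) = eigenvalue_char Z (l ^ CARD('k)) A"
proof -
  obtain a b where affine: "A = scalar_mat2 a + scalar_mat2 b * Z"
    using assms(1) commutant_affine by blast
  show ?thesis
    unfolding affine eigenvalue_char_affine mat2_eigenvalue.eigenvalue_char_affine[OF assms(2)]
    by (simp add: alg_closure_add_power_CARD power_mult_distrib to_ac_power_CARD)
qed

lemma eigenvalue_char_nonzero:
  assumes "A * Z = Z * A" "mat2_det A \<noteq> 0"
  shows "eigenvalue_char Z l A \<noteq> 0" "eigenvalue_char Z conjugate A \<noteq> 0"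
  using eigenvalue_char_conjugate_mult[OF assms(1)] assms(2) by auto

lemma eigenvalue_ratio_power_CARD_minus_1:
  assumes rational: "l ^ CARD('k) = l" and A: "A * Z = Z * A" "mat2_det A \<noteq> 0"
  shows "eigenvalue_ratio A ^ (CARD('k) - 1) = 1"
proof -
  interpret conj: finite_field_mat2_eigenvalue Z conjugate
    by (intro finite_field_mat2_eigenvalue.intro conjugate_eigenvalue)
  have power: "eigenvalue_ratio A ^ CARD('k) = eigenvalue_ratio A"
    using eigenvalue_char_power_CARD[OF A(1)] conj.eigenvalue_char_power_CARD[OF A(1)]
      mat2_eigenvalue_axioms conj.mat2_eigenvalue_axioms
    by (simp add: eigenvalue_ratio_def power_divide conjugate_power_CARD rational)
  have "eigenvalue_ratio A \<noteq> 0"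
    using eigenvalue_char_nonzero[OF A] by (simp add: eigenvalue_ratio_def)
  with power show ?thesis
    by (rule power_minus_1_eq_1) simp
qed

lemma eigenvalue_ratio_power_CARD_plus_1:
  assumes irrational: "l ^ CARD('k) = conjugate" and A: "A * Z = Z * A" "mat2_det A \<noteq> 0"
  shows "eigenvalue_ratio A ^ (CARD('k) + 1) = 1"
proof -
  interpret conj: finite_field_mat2_eigenvalue Z conjugate
    by (intro finite_field_mat2_eigenvalue.intro conjugate_eigenvalue)
  have "eigenvalue_ratio A ^ CARD('k) = inverse (eigenvalue_ratio A)"
    using eigenvalue_char_power_CARD[OF A(1)] conj.eigenvalue_char_power_CARD[OF A(1)]
      mat2_eigenvalue_axioms conj.mat2_eigenvalue_axioms
    by (simp add: eigenvalue_ratio_def power_divide conjugate_power_CARD irrational)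
  then show ?thesis
    using eigenvalue_char_nonzero[OF A] by (simp add: eigenvalue_ratio_def)
qed

lemma involution_scalar_if_irrational:
  assumes irrational: "l ^ CARD('k) = conjugate" and A: "A * Z = Z * A" "A * A = 1"
  shows "A \<in> range scalar_mat2"
proof -
  have "eigenvalue_char Z l A * eigenvalue_char Z l A = 1"
    using eigenvalue_char_mult[OF A(1) A(1)] by (simp add: A(2) eigenvalue_char_1)
  then have "eigenvalue_char Z l A = to_ac 1 \<or> eigenvalue_char Z l A = to_ac (- 1)"
    by (simp add: square_eq_1_iff)
  then have "eigenvalue_char Z l A ^ CARD('k) = eigenvalue_char Z l A"
    using to_ac_power_CARD by metis
  then have "eigenvalue_char Z conjugate A = eigenvalue_char Z l A"
    using eigenvalue_char_power_CARD[OF A(1)] conjugate_eigenvalue by (simp add: irrational)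
  then show ?thesis
    using eigenvalue_char_eq_conjugate_imp_scalar[OF A(1)] by simp
qed

end

section \<open>Matrix groups without nontrivial scalars\<close>

lemma power_one_plus_square_zero:
  fixes e :: "'a::ring_1"
  assumes "e * e = 0"
  shows "(1 + e) ^ n = 1 + of_nat n * e"
proof (induction n)
  case (Suc n)
  have "(1 + e) ^ Suc n = (1 + of_nat n * e) * (1 + e)"
    by (simp only: power_Suc2 Suc.IH)
  also have "\<dots> = 1 + of_nat (Suc n) * e"
    by (simp add: algebra_simps assms)
  finally show ?case .
qed simp

locale finite_mat2_group =
  fixes S :: "'k::field mat2 set"
  assumes group_S: "group (mult_monoid S)"
    and finite_S: "finite S"
    and card_nonzero: "of_nat (card S) \<noteq> (0::'k)"
    and two_nonzero: "(2::'k) \<noteq> 0"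
begin

sublocale S: group "mult_monoid S"
  by (rule group_S)

lemma one_mem: "1 \<in> S"
  using S.one_closed by simp

lemma mult_mem: "A \<in> S \<Longrightarrow> B \<in> S \<Longrightarrow> A * B \<in> S"
  using S.m_closed by simp

lemma inverse_mem:
  assumes "A \<in> S"
  obtains B where "B \<in> S" "A * B = 1" "B * A = 1"
  using assms that[of "inv\<^bsub>mult_monoid S\<^esub> A"] S.inv_closed[of A] S.r_inv[of A] S.l_inv[of A]
  by simp

lemma det_nonzero: "A \<in> S \<Longrightarrow> mat2_det A \<noteq> 0"
  by (metis inverse_mem mat2_det_1 mat2_det_mult mult_zero_left zero_neq_one)

lemma sum_mult_left:
  assumes "A \<in> S"
  shows "(\<Sum>B\<in>S. f (A * B)) = sum f S"
proof -
  have "bij_betw ((*) A) S S"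
    using S.inj_on_cmult[of A] S.surj_const_mult[of A] assms by (simp add: bij_betw_def)
  then show ?thesis
    by (rule sum.reindex_bij_betw)
qed

lemma finite_mat2_group_subgroup:
  assumes "subgroup T (mult_monoid S)"
  shows "finite_mat2_group T"
proof (rule finite_mat2_group.intro)
  have "card (rcosets\<^bsub>mult_monoid S\<^esub> T) * card T = card S"
    using S.lagrange[OF assms] by simp
  then show "of_nat (card T) \<noteq> (0::'k)"
    using card_nonzero by (metis of_nat_mult mult_zero_right)
  show "finite T"
    using subgroup.subset[OF assms] finite_S finite_subset by auto
qed (use two_nonzero subgroup.subgroup_is_group[OF assms group_S] in simp_all)

end

locale scalar_free_mat2_group = finite_mat2_group S for S :: "'k::field mat2 set" +
  assumes scalar_eq_1: "scalar_mat2 c \<in> S \<Longrightarrow> c = 1"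
begin

lemma nonscalar: "A \<in> S \<Longrightarrow> A \<noteq> 1 \<Longrightarrow> A \<notin> range scalar_mat2"
  using scalar_eq_1 by force

lemma scalar_multiple_eq:
  assumes A: "A \<in> S" and B: "B \<in> S" and multiple: "A = scalar_mat2 c * B"
  shows "A = B"
proof -
  obtain C where C: "C \<in> S" "B * C = 1"
    using inverse_mem[OF B] .
  then have "A * C = scalar_mat2 c"
    by (simp add: multiple mult.assoc)
  then have "c = 1"
    using scalar_eq_1 mult_mem[OF A C(1)] by simp
  then show ?thesis
    by (simp add: multiple)
qed

end

locale special_mat2_group = scalar_free_mat2_group S for S :: "'k::field mat2 set" +
  assumes det_eq_1: "A \<in> S \<Longrightarrow> mat2_det A = 1"
begin

lemma mult_adj: "A \<in> S \<Longrightarrow> A * mat2_adj A = 1" "A \<in> S \<Longrightarrow> mat2_adj A * A = 1"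
  by (simp_all add: mult_mat2_adj mat2_adj_mult_self det_eq_1)

lemma adj_mem:
  assumes "A \<in> S"
  shows "mat2_adj A \<in> S"
  using inverse_mem[OF assms] mult_adj(2)[OF assms] by (metis mult.assoc mult_1_left mult_1_right)

lemma tr_eq_2_imp_eq_1:
  assumes A: "A \<in> S" "mat2_tr A = 2"
  shows "A = 1"
proof -
  have "A * A = scalar_mat2 2 * A - 1"
    using mat2_cayley_hamilton[of A] A by (simp add: det_eq_1)
  also have "scalar_mat2 2 * A = A + A"
    by (simp add: mat2_defs)
  finally have "(A - 1) * (A - 1) = 0"
    by (simp add: algebra_simps)
  from power_one_plus_square_zero[OF this, of "card S"]
  have "of_nat (card S) * (A - 1) = 0"
    using S.pow_order_eq_1[of A] A(1) by simp
  moreover have "mat2_det (of_nat (card S)) \<noteq> (0::'k)"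
    using card_nonzero by (simp flip: scalar_mat2_of_nat)
  ultimately have "A - 1 = 0"
    by (rule mat2_mult_eq_0_cancel)
  then show ?thesis
    by simp
qed

lemma inj_on_square: "inj_on (\<lambda>A. A * A) S"
proof (rule inj_onI)
  fix A B assume A: "A \<in> S" and B: "B \<in> S" and eq: "A * A = B * B"
  have multiple: "scalar_mat2 (mat2_tr A) * A = scalar_mat2 (mat2_tr B) * B"
    using eq mat2_cayley_hamilton[of A] mat2_cayley_hamilton[of B] by (simp add: det_eq_1 A B)
  have "mat2_tr A \<noteq> 0"
  proof
    assume "mat2_tr A = 0"
    then have "A * A = scalar_mat2 (- 1)"
      using mat2_cayley_hamilton[of A] A by (simp add: det_eq_1) (simp add: mat2_defs)
    then have "(- 1 :: 'k) = 1"
      using mult_mem[OF A A] scalar_eq_1 by metis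
    then show False
      using two_nonzero by (metis add.right_inverse one_add_one)
  qed
  then have "A = scalar_mat2 (1 / mat2_tr A) * (scalar_mat2 (mat2_tr A) * A)"
    by (simp add: scalar_mat2_mult flip: mult.assoc)
  also have "\<dots> = scalar_mat2 (mat2_tr B / mat2_tr A) * B"
    unfolding multiple by (simp add: scalar_mat2_mult flip: mult.assoc)
  finally show "A = B"
    by (rule scalar_multiple_eq[OF A B])
qed

lemma involution_eq_1: "A \<in> S \<Longrightarrow> A * A = 1 \<Longrightarrow> A = 1"
  using inj_onD[OF inj_on_square, of A 1] one_mem by simp

lemma odd_card: "odd (card S)"
proof
  assume "even (card S)"
  then obtain A where A: "A \<in> S" "S.ord A = 2"
    using S.cauchy_ord[of 2] finite_S by auto
  then have "A * A = 1"
    using S.pow_ord_eq_1[of A] by (simp add: power2_eq_square)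
  then have "A = 1"
    using A(1) by (rule involution_eq_1[rotated])
  then show False
    using A(2) S.ord_id by simp
qed

lemma discr_nonzero:
  assumes A: "A \<in> S" "A \<noteq> 1"
  shows "mat2_discr A \<noteq> 0"
proof
  assume "mat2_discr A = 0"
  then have "mat2_tr (A * A) = 2"
    using A by (simp add: mat2_discr_def mat2_tr_square det_eq_1)
  then have "A * A = 1"
    using A(1) by (intro tr_eq_2_imp_eq_1 mult_mem)
  then show False
    using A involution_eq_1 by blast
qed

lemma sum_eq_0:
  assumes A: "A \<in> S" "A \<noteq> 1"
  shows "\<Sum>S = 0"
proof -
  have "(A - 1) * \<Sum>S = (\<Sum>B\<in>S. A * B) - \<Sum>S"
    by (simp add: sum_distrib_left left_diff_distrib sum_subtractf)
  also have "\<dots> = 0"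
    using sum_mult_left[OF A(1), of "\<lambda>B. B"] by simp
  finally have "(A - 1) * \<Sum>S = 0" .
  moreover have "mat2_det (A - 1) \<noteq> 0"
    using tr_eq_2_imp_eq_1 A by (auto simp: mat2_det_diff_1 det_eq_1)
  ultimately show ?thesis
    by (rule mat2_mult_eq_0_cancel)
qed

definition conj_sum :: "'k mat2 \<Rightarrow> 'k mat2" where
  "conj_sum E = (\<Sum>A\<in>S. A * E * mat2_adj A)"

lemma conj_sum_commute:
  assumes A: "A \<in> S"
  shows "A * conj_sum E = conj_sum E * A"
proof -
  have "A * conj_sum E * mat2_adj A = (\<Sum>B\<in>S. (A * B) * E * mat2_adj (A * B))"
    by (simp add: conj_sum_def sum_distrib_left sum_distrib_right mat2_adj_mult mult.assoc)
  also have "\<dots> = conj_sum E"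
    unfolding conj_sum_def by (rule sum_mult_left[OF A])
  finally have "A * conj_sum E * (mat2_adj A * A) = conj_sum E * A"
    by (simp flip: mult.assoc)
  then show ?thesis
    by (simp add: mult_adj[OF A])
qed

lemma mat2_tr_conj_sum: "mat2_tr (conj_sum E) = of_nat (card S) * mat2_tr E"
proof -
  have "mat2_tr (A * E * mat2_adj A) = mat2_tr E" if "A \<in> S" for A
    using that by (simp add: mat2_tr_mult_commute[of _ "mat2_adj A"] mult_adj flip: mult.assoc)
  then show ?thesis
    by (simp add: conj_sum_def mat2_tr_sum)
qed

lemma schur_orthogonality:
  assumes schur: "\<And>M. (\<And>A. A \<in> S \<Longrightarrow> A * M = M * A) \<Longrightarrow> M \<in> range scalar_mat2"
  shows "scalar_mat2 2 * (\<Sum>A\<in>S. scalar_mat2 (mat2_tr A) * A) = of_nat (card S)"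
proof -
  have twice: "scalar_mat2 2 * conj_sum E = scalar_mat2 (of_nat (card S) * mat2_tr E)" for E
  proof -
    have "conj_sum E \<in> range scalar_mat2"
      using conj_sum_commute by (rule schur)
    then obtain c where scalar: "conj_sum E = scalar_mat2 c"
      by blast
    then have "2 * c = of_nat (card S) * mat2_tr E"
      using mat2_tr_conj_sum[of E] by (simp add: scalar scalar_mat2_def mat2_tr_def)
    then show ?thesis
      by (simp add: scalar scalar_mat2_mult)
  qed
  have "(\<Sum>A\<in>S. scalar_mat2 (mat2_tr A) * A) =
      conj_sum (Mat2 1 0 0 0) * Mat2 1 0 0 0 + conj_sum (Mat2 0 1 0 0) * Mat2 0 0 1 0 +
      conj_sum (Mat2 0 0 1 0) * Mat2 0 1 0 0 + conj_sum (Mat2 0 0 0 1) * Mat2 0 0 0 1"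
    unfolding conj_sum_def sum_distrib_right sum.distrib[symmetric] mat2_sum_matrix_units
    by simp
  also have "scalar_mat2 2 * \<dots> = scalar_mat2 (of_nat (card S))"
    by (simp only: distrib_left mult.assoc[symmetric] twice) (simp add: mat2_defs)
  finally show ?thesis
    by (simp add: scalar_mat2_of_nat)
qed

lemma sum_tr_mult:
  assumes "A \<in> S" "A \<noteq> 1"
  shows "(\<Sum>A\<in>S. scalar_mat2 (mat2_tr A) * A) = of_nat (card S)"
proof -
  have "(\<lambda>A. A * A) ` S = S"
    using endo_inj_surj[OF finite_S _ inj_on_square] mult_mem by auto
  then have "(\<Sum>A\<in>S. A * A) = \<Sum>S"
    using sum.reindex[OF inj_on_square, of "\<lambda>A. A"] by simp
  moreover have "scalar_mat2 (mat2_tr A) * A = A * A + 1" if "A \<in> S" for A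
    using mat2_cayley_hamilton[of A] that by (simp add: det_eq_1)
  ultimately show ?thesis
    by (simp add: sum.distrib sum_eq_0[OF assms])
qed

theorem commute:
  assumes A: "A \<in> S" and B: "B \<in> S"
  shows "A * B = B * A"
proof (rule ccontr)
  assume noncommuting: "A * B \<noteq> B * A"
  have "M \<in> range scalar_mat2" if "\<And>C. C \<in> S \<Longrightarrow> C * M = M * C" for M
    using noncommuting commute_nonscalar_mat2_trans that A B by blast
  then have "scalar_mat2 2 * (\<Sum>C\<in>S. scalar_mat2 (mat2_tr C) * C) = of_nat (card S)"
    by (rule schur_orthogonality)
  moreover have "A \<noteq> 1"
    using noncommuting by auto
  ultimately have "scalar_mat2 2 * of_nat (card S) = (of_nat (card S) :: 'k mat2)"
    using sum_tr_mult[OF A] by simp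
  then have "(2::'k) * of_nat (card S) = of_nat (card S)"
    by (simp only: scalar_mat2_mult scalar_mat2_eq_iff flip: scalar_mat2_of_nat)
  then show False
    using card_nonzero by (metis add_cancel_right_right mult_2)
qed

end

context scalar_free_mat2_group
begin

definition SL :: "'k mat2 set" where
  "SL = {A \<in> S. mat2_det A = 1}"

lemma mem_SL: "A \<in> SL \<Longrightarrow> A \<in> S"
  by (simp add: SL_def)

lemma subgroup_SL: "subgroup SL (mult_monoid S)"
proof (rule S.subgroupI)
  fix A assume A: "A \<in> SL"
  let ?B = "inv\<^bsub>mult_monoid S\<^esub> A"
  have B: "?B \<in> S" "A * ?B = 1"
    using A S.inv_closed[of A] S.r_inv[of A] by (simp_all add: SL_def)
  then have "mat2_det A * mat2_det ?B = 1"
    by (simp flip: mat2_det_mult)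
  then show "?B \<in> SL"
    using A B by (simp add: SL_def)
qed (use one_mem in \<open>auto simp: SL_def mult_mem mat2_det_mult\<close>)

lemma special_mat2_group_SL: "special_mat2_group SL"
proof -
  interpret SL: finite_mat2_group SL
    by (rule finite_mat2_group_subgroup[OF subgroup_SL])
  show ?thesis
    by unfold_locales (auto simp: SL_def scalar_eq_1)
qed

definition centralizer :: "'k mat2 \<Rightarrow> 'k mat2 set" where
  "centralizer Z = {A \<in> S. A * Z = Z * A}"

lemma centralizerD:
  assumes "A \<in> centralizer Z"
  shows "A \<in> S" "A * Z = Z * A" "mat2_det A \<noteq> 0"
  using assms by (simp_all add: centralizer_def det_nonzero)

lemma subgroup_centralizer:
  assumes "Z \<in> S"
  shows "subgroup (centralizer Z) (mult_monoid S)"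
proof (rule S.subgroupI)
  fix A assume A: "A \<in> centralizer Z"
  let ?B = "inv\<^bsub>mult_monoid S\<^esub> A"
  have B: "?B \<in> S" "A * ?B = 1" "?B * A = 1"
    using A S.inv_closed[of A] S.r_inv[of A] S.l_inv[of A] by (simp_all add: centralizer_def)
  have "?B * Z = ?B * (Z * A) * ?B"
    using B(2) by (simp add: mult.assoc)
  also have "\<dots> = ?B * (A * Z) * ?B"
    using A by (simp add: centralizer_def)
  also have "\<dots> = Z * ?B"
    using B(3) by (simp flip: mult.assoc)
  finally show "?B \<in> centralizer Z"
    using B(1) by (simp add: centralizer_def)
next
  fix A B assume AB: "A \<in> centralizer Z" "B \<in> centralizer Z"
  then have "A * B * Z = A * (Z * B)"
    by (simp add: centralizer_def mult.assoc)
  also have "\<dots> = Z * A * B"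
    using AB by (simp add: centralizer_def flip: mult.assoc)
  finally have "A * B * Z = Z * (A * B)"
    by (simp add: mult.assoc)
  then show "A \<otimes>\<^bsub>mult_monoid S\<^esub> B \<in> centralizer Z"
    using AB by (simp add: centralizer_def mult_mem)
qed (use one_mem in \<open>auto simp: centralizer_def\<close>)

context
  fixes Z
  assumes Z: "Z \<in> SL" "Z \<noteq> 1"
begin

interpretation SL: special_mat2_group SL
  by (rule special_mat2_group_SL)

lemma discr_nonzero_if_mem_SL: "mat2_discr Z \<noteq> 0"
  by (rule SL.discr_nonzero[OF Z])

lemma intertwines_adj:
  assumes W: "W \<in> S" "W \<notin> centralizer Z"
  shows "W * Z = mat2_adj Z * W"
proof -
  obtain V where V: "V \<in> S" "W * V = 1" "V * W = 1"
    using inverse_mem[OF W(1)] .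
  let ?Y = "W * Z * V"
  have "mat2_det W * mat2_det V = 1"
    using V(2) by (simp flip: mat2_det_mult)
  then have det: "mat2_det ?Y = mat2_det Z"
    by (simp add: mat2_det_mult mult.assoc mult.left_commute)
  then have "?Y \<in> SL"
    using W(1) V(1) Z(1) by (simp add: SL_def mult_mem)
  then have "?Y * Z = Z * ?Y"
    using SL.commute Z(1) by blast
  moreover have "mat2_tr ?Y = mat2_tr Z"
    using V(3) by (simp add: mat2_tr_mult_commute[of _ V] flip: mult.assoc)
  ultimately have "?Y = Z \<or> ?Y = mat2_adj Z"
    using commuting_mat2_same_charpoly[OF _ discr_nonzero_if_mem_SL] det by blast
  moreover have "?Y * W = W * Z"
    using V(3) by (simp add: mult.assoc)
  moreover have "W * Z \<noteq> Z * W"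
    using W by (simp add: centralizer_def)
  ultimately show ?thesis
    by metis
qed

lemma intertwines_adj_commutant:
  assumes W: "W \<in> S" "W \<notin> centralizer Z" and A: "A * Z = Z * A"
  shows "W * A = mat2_adj A * W"
  using mat2_adj_intertwines_commutant[OF intertwines_adj[OF W] A]
    mat2_discr_nonzero_imp_nonscalar[OF discr_nonzero_if_mem_SL] .

lemma mult_mem_centralizer:
  assumes V: "V \<in> S" "V \<notin> centralizer Z" and W: "W \<in> S" "W \<notin> centralizer Z"
  shows "V * W \<in> centralizer Z"
proof -
  have "mat2_adj Z * Z = Z * mat2_adj Z"
    by (simp add: mult_mat2_adj mat2_adj_mult_self)
  then have "V * mat2_adj Z = mat2_adj (mat2_adj Z) * V"
    by (rule intertwines_adj_commutant[OF V])
  then have "V * W * Z = Z * (V * W)"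
    using intertwines_adj[OF W]
    by (simp add: mat2_adj_def mult.assoc) (simp flip: mult.assoc)
  then show ?thesis
    using V(1) W(1) by (simp add: centralizer_def mult_mem)
qed

lemma square_eq_1_if_not_mem_centralizer:
  assumes W: "W \<in> S" "W \<notin> centralizer Z"
  shows "W * W = 1"
proof -
  have "W * W \<in> centralizer Z"
    by (rule mult_mem_centralizer[OF W W])
  then have "W * (W * W) = mat2_adj (W * W) * W"
    by (intro intertwines_adj_commutant[OF W]) (simp add: centralizer_def)
  moreover obtain V where "V \<in> S" "W * V = 1"
    using inverse_mem[OF W(1)] .
  ultimately have "mat2_adj (W * W) = W * W"
    by (metis mult.assoc mult_1_right)
  then have "W * W \<in> range scalar_mat2"
    by (rule self_adjugate_mat2_scalar[OF _ two_nonzero])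
  then show ?thesis
    using nonscalar mult_mem[OF W(1) W(1)] by blast
qed

lemma centralizer_eq_SL:
  assumes W: "W \<in> S" "W \<notin> centralizer Z"
  shows "centralizer Z = SL"
proof
  show "SL \<subseteq> centralizer Z"
    using SL.commute Z(1) mem_SL by (auto simp: centralizer_def)
  show "centralizer Z \<subseteq> SL"
  proof
    fix A assume A: "A \<in> centralizer Z"
    then have "W * A = mat2_adj A * W"
      by (intro intertwines_adj_commutant[OF W]) (simp add: centralizer_def)
    then have "A * (W * A) * W = scalar_mat2 (mat2_det A)"
      using square_eq_1_if_not_mem_centralizer[OF W]
      by (simp add: mult.assoc) (simp add: mult_mat2_adj flip: mult.assoc)
    moreover have "A * (W * A) * W \<in> S"
      using A W(1) by (simp add: centralizer_def mult_mem)
    ultimately have "mat2_det A = 1"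
      using scalar_eq_1 by simp
    then show "A \<in> SL"
      using A by (simp add: SL_def centralizer_def)
  qed
qed

lemma card_eq_2_card_SL:
  assumes W: "W \<in> S" "W \<notin> SL" and "centralizer Z = SL"
  shows "card S = 2 * card SL"
proof -
  have WW: "W * W = 1"
    using square_eq_1_if_not_mem_centralizer assms by simp
  have "bij_betw (\<lambda>A. A * W) SL (S - SL)"
  proof (rule bij_betw_byWitness[where f' = "\<lambda>A. A * W"])
    show "(\<lambda>A. A * W) ` (S - SL) \<subseteq> SL"
      using mult_mem_centralizer assms by auto
    show "(\<lambda>A. A * W) ` SL \<subseteq> S - SL"
      using W by (auto simp: SL_def mult_mem mat2_det_mult)
  qed (simp_all add: mult.assoc WW)
  then have "card (S - SL) = card SL"
    by (simp add: bij_betw_same_card)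
  moreover have "card (S - SL) = card S - card SL"
    using SL.finite_S mem_SL by (intro card_Diff_subset) auto
  moreover have "card SL \<le> card S"
    using finite_S mem_SL by (intro card_mono) auto
  ultimately show ?thesis
    by simp
qed

lemma iso_dihedral_group_if_not_mem_centralizer:
  assumes W: "W \<in> S" "W \<notin> centralizer Z" and cyclic: "cyclic_group (mult_monoid (centralizer Z))"
  shows "mult_monoid S \<cong> dihedral_group (card SL)"
proof -
  have centralizer: "centralizer Z = SL"
    by (rule centralizer_eq_SL[OF W])
  obtain R where R: "R \<in> SL" "SL = generate (mult_monoid S) {R}"
    using S.cyclic_subgroup_generator[OF subgroup_SL] cyclic by (auto simp: centralizer)
  have ord: "S.ord R = card SL"
    using S.generate_pow_card[of R] R by (simp add: mem_SL)
  have WW: "W * W = 1"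
    by (rule square_eq_1_if_not_mem_centralizer[OF W])
  have "W * R * W = mat2_adj R"
    using intertwines_adj_commutant[OF W, of R] R(1) WW
    by (simp add: centralizer_def mult.assoc flip: centralizer)
  moreover have "inv\<^bsub>mult_monoid S\<^esub> R = mat2_adj R"
    using SL.mult_adj SL.adj_mem R(1) by (intro S.inv_equality) (simp_all add: mem_SL)
  ultimately have "mult_monoid S \<cong> dihedral_group (S.ord R)"
    using W R finite_S WW card_eq_2_card_SL[of W]
    by (intro S.iso_dihedral_group[of R W]) (simp_all add: mem_SL ord centralizer)
  then show ?thesis
    by (simp add: ord)
qed

end

end

locale finite_field_mat2_group = scalar_free_mat2_group S for S :: "'k::finite_field mat2 set"
begin

lemma cyclic_if_SL_trivial:
  assumes "SL = {1}"
  shows "cyclic_group (mult_monoid S)" "card S dvd CARD('k) - 1"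
proof -
  have "A = 1" if "A \<in> S" "mat2_det A = 1" for A
    using that assms by (auto simp: SL_def)
  moreover have "mat2_det A ^ (CARD('k) - 1) = 1" if "A \<in> S" for A
    by (rule power_minus_1_eq_1[OF finite_field_power_card_eq_same det_nonzero[OF that]]) simp
  ultimately show "cyclic_group (mult_monoid S)" "card S dvd CARD('k) - 1"
    using S.cyclic_group_if_embeds_in_field[of mat2_det "CARD('k) - 1"] finite_S
      CARD_finite_field_gt_1[where 'k = 'k]
    by (simp_all add: mat2_det_mult)
qed

context
  fixes Z l
  assumes Z: "Z \<in> S" and eigenvalue: "mat2_eigenvalue Z l"
begin

interpretation finite_field_mat2_eigenvalue Z l
  by (rule finite_field_mat2_eigenvalue.intro[OF eigenvalue])

interpretation C: group "mult_monoid (centralizer Z)"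
  using subgroup.subgroup_is_group[OF subgroup_centralizer[OF Z] group_S] by simp

lemma eq_1_if_eigenvalue_ratio_eq_1:
  assumes A: "A \<in> centralizer Z" and ratio: "eigenvalue_ratio A = 1"
  shows "A = 1"
proof -
  have "eigenvalue_char Z l A = eigenvalue_char Z conjugate A"
    using eigenvalue_char_nonzero centralizerD[OF A] ratio by (simp add: eigenvalue_ratio_def)
  then show ?thesis
    using eigenvalue_char_eq_conjugate_imp_scalar nonscalar centralizerD[OF A] by blast
qed

lemma cyclic_centralizer_if_eigenvalue_ratio_power:
  assumes "e > 0" "\<And>A. A \<in> centralizer Z \<Longrightarrow> eigenvalue_ratio A ^ e = 1"
  shows "cyclic_group (mult_monoid (centralizer Z)) \<and> card (centralizer Z) dvd e"
proof -
  have "finite (centralizer Z)"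
    using finite_S by (simp add: centralizer_def)
  then show ?thesis
    using C.cyclic_group_if_embeds_in_field[of eigenvalue_ratio e] assms
      eq_1_if_eigenvalue_ratio_eq_1 centralizerD[where Z = Z]
    by (simp add: eigenvalue_ratio_mult)
qed

lemma odd_card_centralizer_if_irrational:
  assumes irrational: "l ^ CARD('k) = conjugate"
  shows "odd (card (centralizer Z))"
proof
  assume "even (card (centralizer Z))"
  moreover have "finite (centralizer Z)"
    using finite_S by (simp add: centralizer_def)
  ultimately obtain A where A: "A \<in> centralizer Z" "C.ord A = 2"
    using C.cauchy_ord[of 2] by auto
  then have "A * A = 1"
    using C.pow_ord_eq_1[of A] by (simp add: power2_eq_square)
  then have "A = 1"
    using involution_scalar_if_irrational[OF irrational] nonscalar centralizerD[OF A(1)] by blast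
  then show False
    using A(2) C.ord_id by simp
qed

end

lemma cyclic_centralizer:
  assumes Z: "Z \<in> S" "mat2_discr Z \<noteq> 0"
  shows "cyclic_group (mult_monoid (centralizer Z)) \<and>
    (card (centralizer Z) dvd CARD('k) - 1 \<or>
     card (centralizer Z) dvd CARD('k) + 1 \<and> odd (card (centralizer Z)))"
proof -
  obtain l where eigenvalue: "mat2_eigenvalue Z l"
    using ex_mat2_eigenvalue[OF Z(2)] .
  then interpret finite_field_mat2_eigenvalue Z l
    by (rule finite_field_mat2_eigenvalue.intro)
  note cyclic = cyclic_centralizer_if_eigenvalue_ratio_power[OF Z(1) eigenvalue]
  show ?thesis
    using frobenius_cases
  proof
    assume "l ^ CARD('k) = l"
    then show ?thesis
      using cyclic[of "CARD('k) - 1"] eigenvalue_ratio_power_CARD_minus_1 centralizerD[where Z = Z]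
        CARD_finite_field_gt_1[where 'k = 'k]
      by simp
  next
    assume irrational: "l ^ CARD('k) = conjugate"
    then show ?thesis
      using cyclic[of "CARD('k) + 1"] eigenvalue_ratio_power_CARD_plus_1[OF irrational]
        centralizerD[where Z = Z]
        odd_card_centralizer_if_irrational[OF Z(1) eigenvalue irrational]
      by simp
  qed
qed

theorem cyclic_or_dihedral:
  obtains (cyclic) "cyclic_group (mult_monoid S)"
      "card S dvd CARD('k) - 1 \<or> card S dvd CARD('k) + 1 \<and> odd (card S)"
  | (dihedral) "mult_monoid S \<cong> dihedral_group (card SL)" "odd (card SL)" "card SL \<ge> 3"
      "card SL dvd CARD('k) - 1 \<or> card SL dvd CARD('k) + 1"
      "\<And>A. A \<in> S - SL \<Longrightarrow> A * A = 1"
proof (cases "SL = {1}")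
  case True
  then show ?thesis
    using cyclic cyclic_if_SL_trivial by blast
next
  case False
  interpret SL: special_mat2_group SL
    by (rule special_mat2_group_SL)
  obtain Z where Z: "Z \<in> SL" "Z \<noteq> 1"
    using False SL.one_mem by blast
  note cyclic_C = cyclic_centralizer[OF mem_SL[OF Z(1)] discr_nonzero_if_mem_SL[OF Z]]
  show ?thesis
  proof (cases "centralizer Z = S")
    case True
    then show ?thesis
      using cyclic cyclic_C by simp
  next
    case False
    then obtain W where W: "W \<in> S" "W \<notin> centralizer Z"
      by (auto simp: centralizer_def)
    have C_eq: "centralizer Z = SL"
      by (rule centralizer_eq_SL[OF Z W])
    have "card SL \<noteq> 1"
      using Z SL.one_mem by (auto simp: card_1_singleton_iff)
    then have "card SL \<ge> 3"
      using SL.odd_card by (auto elim!: oddE)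
    then show ?thesis
      using iso_dihedral_group_if_not_mem_centralizer[OF Z W] SL.odd_card cyclic_C
        square_eq_1_if_not_mem_centralizer[OF Z]
      by (intro dihedral) (auto simp: C_eq)
  qed
qed

end

section \<open>Extremal matrix groups\<close>

text \<open>
  The line \<open>L\<close> is spanned by the first basis vector. In the locale below, \<open>A V = V\<close> says that \<open>A\<close>
  fixes both columns of \<open>V\<close>.
\<close>

definition line_stabilizer :: "'k::zero mat2 set \<Rightarrow> 'k mat2 set" where
  "line_stabilizer S = {A \<in> S. mat21 A = 0}"

locale extremal_mat2_group = finite_mat2_group S for S :: "'k::finite_field mat2 set" +
  assumes stabilizer_fixes: "A \<in> line_stabilizer S \<Longrightarrow> mat11 A = 1"
    and invariants_trivial: "(\<And>A. A \<in> S \<Longrightarrow> A * V = V) \<Longrightarrow> V = 0"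
begin

sublocale finite_field_mat2_group S
proof unfold_locales
  fix c assume "scalar_mat2 c \<in> S"
  then show "c = 1"
    using stabilizer_fixes[of "scalar_mat2 c"] by (simp add: line_stabilizer_def scalar_mat2_def)
qed

lemma card_ge_3: "card S \<ge> 3"
proof (rule ccontr)
  assume "\<not> card S \<ge> 3"
  moreover have "card S \<noteq> 0"
    using card_nonzero by (intro notI) simp
  ultimately consider (trivial) "card S = 1" | (involution) "card S = 2"
    by linarith
  then show False
  proof cases
    case trivial
    then have "S = {1}"
      using one_mem by (auto simp: card_1_singleton_iff)
    then show False
      using invariants_trivial[of 1] by simp
  next
    case involution
    then obtain A where A: "S = {1, A}" "A \<noteq> 1"
      using one_mem by (auto simp: card_2_iff)
    have "A * A = 1"
      using S.pow_order_eq_1[of A] A involution by (simp add: power2_eq_square)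
    then have "1 + A = 0"
      using A by (intro invariants_trivial) (auto simp: algebra_simps)
    then have "A = scalar_mat2 (- 1)"
      by (simp add: mat2_defs add_eq_0_iff)
    then show False
      using A nonscalar by blast
  qed
qed

lemma line_stabilizer_eq_1_if_cyclic:
  assumes cyclic: "cyclic_group (mult_monoid S)"
  shows "line_stabilizer S = {1}"
proof (rule ccontr)
  assume "line_stabilizer S \<noteq> {1}"
  moreover have "1 \<in> line_stabilizer S"
    using one_mem by (simp add: line_stabilizer_def one_mat2_def)
  ultimately obtain A where A: "A \<in> line_stabilizer S" "A \<noteq> 1"
    by blast
  have "mat21 B = 0" if B: "B \<in> S" for B
  proof (rule ccontr)
    assume "mat21 B \<noteq> 0"
    have "A * B = B * A"
      using comm_groupE(4)[OF S.cyclic_imp_abelian_group[OF cyclic]] A(1) B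
      by (simp add: line_stabilizer_def)
    from arg_cong[OF this, of mat11] arg_cong[OF this, of mat21]
    have "mat12 A = 0" "mat22 A = 1"
      using \<open>mat21 B \<noteq> 0\<close> A(1) stabilizer_fixes[OF A(1)]
      by (simp_all add: line_stabilizer_def times_mat2_def)
    then show False
      using A stabilizer_fixes[OF A(1)] by (simp add: line_stabilizer_def one_mat2_def mat2_eq_iff)
  qed
  then have "B * Mat2 1 0 0 0 = Mat2 1 0 0 0" if "B \<in> S" for B
    using that stabilizer_fixes[of B] by (simp add: line_stabilizer_def times_mat2_def)
  then have "Mat2 1 0 0 (0::'k) = 0"
    by (rule invariants_trivial)
  then show False
    by (simp add: zero_mat2_def)
qed

lemma line_stabilizer_entries:
  assumes "A \<in> line_stabilizer S"
  shows "A \<in> S" "mat21 A = 0" "mat11 A = 1" "mat2_det A = mat22 A" "mat2_tr A = 1 + mat22 A"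
  using assms stabilizer_fixes[OF assms]
  by (simp_all add: line_stabilizer_def mat2_det_def mat2_tr_def)

lemma line_stabilizer_eq_1_if_mat22_eq_1:
  assumes A: "A \<in> line_stabilizer S" "mat22 A = 1"
  shows "A = 1"
proof -
  interpret SL: special_mat2_group SL
    by (rule special_mat2_group_SL)
  show ?thesis
    using line_stabilizer_entries[OF A(1)] A(2)
    by (intro SL.tr_eq_2_imp_eq_1) (simp_all add: SL_def)
qed

lemma card_line_stabilizer_le_2:
  assumes involution: "\<And>A. A \<in> S - SL \<Longrightarrow> A * A = 1"
  shows "card (line_stabilizer S) \<le> 2"
proof -
  have reflection: "A * A = 1" "mat22 A = - 1" if A: "A \<in> line_stabilizer S" "A \<noteq> 1" for A
  proof -
    have "mat22 A \<noteq> 1"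
      using line_stabilizer_eq_1_if_mat22_eq_1 A by blast
    then show "A * A = 1"
      using line_stabilizer_entries[OF A(1)] by (intro involution) (simp add: SL_def)
    then have "mat22 A * mat22 A = 1"
      using line_stabilizer_entries[OF A(1)] by (simp add: times_mat2_def one_mat2_def)
    then show "mat22 A = - 1"
      using \<open>mat22 A \<noteq> 1\<close> by (simp add: square_eq_1_iff)
  qed
  have "B = A"
    if A: "A \<in> line_stabilizer S" "A \<noteq> 1" and B: "B \<in> line_stabilizer S" "B \<noteq> 1" for A B
  proof -
    have "A * B \<in> line_stabilizer S" "mat22 (A * B) = 1"
      using line_stabilizer_entries[OF A(1)] line_stabilizer_entries[OF B(1)]
        reflection[OF A] reflection[OF B] mult_mem
      by (simp_all add: line_stabilizer_def) (simp_all add: times_mat2_def)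
    then have "A * B = 1"
      by (rule line_stabilizer_eq_1_if_mat22_eq_1)
    then have "A * (A * B) = A"
      by simp
    then show "B = A"
      using reflection(1)[OF A] by (simp flip: mult.assoc)
  qed
  then obtain A where "line_stabilizer S \<subseteq> {1, A}"
    by blast
  then have "card (line_stabilizer S) \<le> card {1, A}"
    by (intro card_mono) auto
  also have "\<dots> \<le> 2"
    by (simp add: card_insert_if)
  finally show ?thesis .
qed

end

theorem (in extremal_mat2_group) isomorphic_group_cases:
  assumes "group Q" and M: "M \<in> iso Q (mult_monoid S)"
    and K: "subgroup K Q" and M_K: "M ` K \<subseteq> line_stabilizer S"
  obtains (cyclic) "cyclic_group Q" "Q \<cong> integer_mod_group (Coset.order Q)" "Coset.order Q \<ge> 3"
      "K = {\<one>\<^bsub>Q\<^esub>}"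
      "Coset.order Q dvd CARD('k) - 1 \<or> Coset.order Q dvd CARD('k) + 1 \<and> odd (Coset.order Q)"
  | (dihedral) d where "Q \<cong> dihedral_group d" "Coset.order Q = 2 * d" "odd d" "d \<ge> 3"
      "card K \<le> 2" "d dvd CARD('k) - 1 \<or> d dvd CARD('k) + 1"
proof -
  interpret Q: group Q
    by (fact \<open>group Q\<close>)
  have iso: "Q \<cong> mult_monoid S"
    using M by (rule is_isoI)
  have finite_Q: "finite (carrier Q)" and order_Q: "Coset.order Q = card S"
    using iso_finite[OF iso] iso_same_card[OF iso] finite_S by (simp_all add: Coset.order_def)
  have "inj_on M K"
    using M subgroup.subset[OF K] by (auto simp: iso_def bij_betw_def intro: inj_on_subset)
  then have card_K: "card K \<le> card (line_stabilizer S)"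
    using M_K finite_S by (intro card_inj_on_le) (auto simp: line_stabilizer_def)
  show ?thesis
    using cyclic_or_dihedral
  proof cases
    case cyclic
    have "card K \<le> 1"
      using card_K line_stabilizer_eq_1_if_cyclic[OF cyclic(1)] by simp
    moreover have "finite K"
      using subgroup.subset[OF K] finite_Q finite_subset by blast
    ultimately have "K = {\<one>\<^bsub>Q\<^esub>}"
      using subgroup.one_closed[OF K] card_le_Suc0_iff_eq by auto
    moreover have "cyclic_group Q"
      using isomorphic_group_cyclicity[OF iso \<open>group Q\<close> group_S] cyclic(1) by simp
    ultimately show ?thesis
      using that(1) Q.iso_integer_mod_group[OF finite_Q] cyclic(2) card_ge_3
      by (simp add: order_Q)
  next
    case dihedral
    have "Q \<cong> dihedral_group (card SL)"
      using iso dihedral(1) by (rule iso_trans)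
    moreover have "Coset.order Q = 2 * card SL"
      using iso_same_card[OF \<open>Q \<cong> dihedral_group (card SL)\<close>] order_dihedral_group[of "card SL"]
      by (simp add: Coset.order_def)
    moreover have "card K \<le> 2"
      using card_K card_line_stabilizer_le_2 dihedral(5) by fastforce
    ultimately show ?thesis
      using that(2) dihedral(2-4) by blast
  qed
qed

section \<open>Extremal representations\<close>

locale plane_basis = vector_space scale
  for scale :: "'k::field \<Rightarrow> 'v::ab_group_add \<Rightarrow> 'v" (infixr \<open>*s\<close> 75) +
  fixes e1 e2 :: 'v
  assumes independent_basis: "independent {e1, e2}" and distinct_basis: "e1 \<noteq> e2"
    and span_basis: "span {e1, e2} = UNIV"
begin

definition coord1 :: "'v \<Rightarrow> 'k" where
  "coord1 x = representation {e1, e2} x e1"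

definition coord2 :: "'v \<Rightarrow> 'k" where
  "coord2 x = representation {e1, e2} x e2"

lemma coord_decomposition: "coord1 x *s e1 + coord2 x *s e2 = x"
  using sum_representation_eq[OF independent_basis, of x "{e1, e2}"]
  by (simp add: coord1_def coord2_def span_basis distinct_basis)

lemma coord_combination [simp]:
  "coord1 (a *s e1 + b *s e2) = a" "coord2 (a *s e1 + b *s e2) = b"
  using distinct_basis
  by (simp_all add: coord1_def coord2_def representation_add representation_scale
      representation_basis independent_basis span_basis)

lemma coord_basis [simp]: "coord1 e1 = 1" "coord2 e1 = 0" "coord1 e2 = 0" "coord2 e2 = 1"
  using coord_combination[of 1 0] coord_combination[of 0 1] by simp_all

definition matrix_of :: "('v \<Rightarrow> 'v) \<Rightarrow> 'k mat2" where
  "matrix_of f = Mat2 (coord1 (f e1)) (coord1 (f e2)) (coord2 (f e1)) (coord2 (f e2))"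

lemma linear_combination_matrix_of:
  assumes "Vector_Spaces.linear scale scale f"
  shows "f (a *s e1 + b *s e2) =
    (mat11 (matrix_of f) * a + mat12 (matrix_of f) * b) *s e1 +
    (mat21 (matrix_of f) * a + mat22 (matrix_of f) * b) *s e2"
proof -
  interpret f: Vector_Spaces.linear scale scale f
    by fact
  have "f (a *s e1 + b *s e2) = a *s (coord1 (f e1) *s e1 + coord2 (f e1) *s e2) +
      b *s (coord1 (f e2) *s e1 + coord2 (f e2) *s e2)"
    by (simp only: f.add f.scale coord_decomposition)
  then show ?thesis
    by (simp add: matrix_of_def algebra_simps)
qed

lemma matrix_of_comp:
  assumes "Vector_Spaces.linear scale scale f"
  shows "matrix_of (f \<circ> g) = matrix_of f * matrix_of g"
proof -
  have "f (g x) = (mat11 (matrix_of f) * coord1 (g x) + mat12 (matrix_of f) * coord2 (g x)) *s e1 +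
    (mat21 (matrix_of f) * coord1 (g x) + mat22 (matrix_of f) * coord2 (g x)) *s e2" for x
    using linear_combination_matrix_of[OF assms, of "coord1 (g x)" "coord2 (g x)"]
    by (simp add: coord_decomposition)
  then have
    "coord1 (f (g x)) = mat11 (matrix_of f) * coord1 (g x) + mat12 (matrix_of f) * coord2 (g x)"
    "coord2 (f (g x)) = mat21 (matrix_of f) * coord1 (g x) + mat22 (matrix_of f) * coord2 (g x)"
    for x
    by simp_all
  then show ?thesis
    by (simp add: matrix_of_def times_mat2_def)
qed

lemma matrix_of_id: "matrix_of id = 1"
  by (simp add: matrix_of_def one_mat2_def)

lemma matrix_of_inject:
  assumes "Vector_Spaces.linear scale scale f" "Vector_Spaces.linear scale scale g"
    and "matrix_of f = matrix_of g"
  shows "f = g"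
proof
  fix x
  have "f (coord1 x *s e1 + coord2 x *s e2) = g (coord1 x *s e1 + coord2 x *s e2)"
    using assms by (simp add: linear_combination_matrix_of)
  then show "f x = g x"
    by (simp only: coord_decomposition)
qed

lemma iso_matrix_of:
  assumes "F \<subseteq> carrier (general_linear_group scale)"
  shows "matrix_of \<in> iso (general_linear_group scale\<lparr>carrier := F\<rparr>) (mult_monoid (matrix_of ` F))"
proof -
  have linear: "Vector_Spaces.linear scale scale f" if "f \<in> F" for f
    using that assms by (auto simp: general_linear_group_def)
  then have "inj_on matrix_of F"
    using matrix_of_inject by (intro inj_onI) blast
  then show ?thesis
    using linear
    by (simp add: iso_def hom_def bij_betw_def general_linear_group_def matrix_of_comp)
qed

lemma image_line_if_mat21_eq_0:
  assumes f: "f \<in> carrier (general_linear_group scale)" and "mat21 (matrix_of f) = 0"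
  shows "f ` span {e1} = span {e1}"
proof -
  have linear: "Vector_Spaces.linear scale scale f" and bij: "bij f"
    using f by (auto simp: general_linear_group_def)
  interpret f: Vector_Spaces.linear scale scale f
    by (fact linear)
  let ?a = "mat11 (matrix_of f)"
  have f_e1: "f e1 = ?a *s e1"
    using linear_combination_matrix_of[OF linear, of 1 0] assms(2) by simp
  have "?a \<noteq> 0"
  proof
    assume "?a = 0"
    then have "f e1 = f 0"
      using f_e1 f.zero by simp
    then have "e1 = 0"
      by (rule injD[OF bij_is_inj[OF bij]])
    then show False
      using coord_basis(1) coord_combination(1)[of 0 0] by simp
  qed
  then have "span {?a *s e1} = span {e1}"
    using span_image_scale[of "{e1}" "\<lambda>_. ?a"] by simp
  then show ?thesis
    by (simp add: f.span_image[symmetric] f_e1)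
qed

end

lemma (in vector_space) plane_basis_of_line:
  assumes dim: "dim (UNIV :: 'b set) = 2" and L: "subspace L" "dim L = 1"
  obtains e1 e2 where "plane_basis scale e1 e2" "L = span {e1}"
proof -
  obtain B where basis: "B \<subseteq> L" "independent B" "L \<subseteq> span B" "card B = dim L"
    by (rule basis_exists)
  then obtain e1 where basis_eq: "B = {e1}"
    using L(2) card_1_singletonE by metis
  obtain B' where B': "{e1} \<subseteq> B'" "independent B'" "UNIV \<subseteq> span B'"
    using maximal_independent_subset_extend[of "{e1}" UNIV] basis(2) basis_eq by auto
  have "card B' = 2"
    using basis_card_eq_dim[of B' UNIV] B' dim by simp
  then obtain e2 where "B' = {e1, e2}" "e1 \<noteq> e2"
    using B'(1) by (auto simp: card_2_iff)
  then have "plane_basis scale e1 e2"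
    using B' by unfold_locales auto
  moreover have "L = span {e1}"
    using basis span_minimal[OF basis(1) L(1)] by (auto simp: basis_eq)
  ultimately show ?thesis
    by (rule that)
qed

lemma (in plane_basis) finite_mat2_group_matrix_of_image:
  assumes \<rho>: "group_hom G (general_linear_group scale) \<rho>"
    and finite: "finite (carrier G)" and order: "of_nat (Coset.order G) \<noteq> (0::'k)"
    and two: "(2::'k) \<noteq> 0"
  shows "finite_mat2_group (matrix_of ` \<rho> ` carrier G)"
proof (rule finite_mat2_group.intro)
  interpret \<rho>: group_hom G "general_linear_group scale" \<rho>
    by (fact \<rho>)
  let ?F = "\<rho> ` carrier G"
  have iso: "matrix_of \<in> iso (general_linear_group scale\<lparr>carrier := ?F\<rparr>) 
      (mult_monoid (matrix_of ` ?F))"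
    using \<rho>.hom_closed by (intro iso_matrix_of) auto
  have "group (general_linear_group scale\<lparr>carrier := ?F\<rparr>)"
    by (rule subgroup.subgroup_is_group[OF \<rho>.img_is_subgroup \<rho>.H.is_group])
  from group.iso_imp_img_group[OF this iso] show "group (mult_monoid (matrix_of ` ?F))"
    by (simp add: general_linear_group_def matrix_of_id mult_monoid_def)
  show "finite (matrix_of ` ?F)"
    using finite by simp
  have "inj_on matrix_of ?F"
    using iso by (simp add: iso_def bij_betw_def)
  then have "card (matrix_of ` ?F) dvd Coset.order G"
    using \<rho>.card_image_dvd_order by (simp add: card_image)
  then obtain n where "Coset.order G = card (matrix_of ` ?F) * n"
    by (rule dvdE)
  then show "of_nat (card (matrix_of ` ?F)) \<noteq> (0::'k)"
    using order by auto
qed (fact two)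

lemma (in plane_basis) invariants_trivial_imp_mat2_eq_0:
  assumes linear: "\<And>g. g \<in> carrier G \<Longrightarrow> Vector_Spaces.linear scale scale (\<rho> g)"
    and invariants: "invariants G \<rho> = {0}"
    and fixed: "\<And>g. g \<in> carrier G \<Longrightarrow> matrix_of (\<rho> g) * U = U"
  shows "U = 0"
proof -
  have zero: "a = 0 \<and> b = 0"
    if "\<And>g. g \<in> carrier G \<Longrightarrow>
      mat11 (matrix_of (\<rho> g)) * a + mat12 (matrix_of (\<rho> g)) * b = a \<and>
      mat21 (matrix_of (\<rho> g)) * a + mat22 (matrix_of (\<rho> g)) * b = b" for a b
  proof -
    have "a *s e1 + b *s e2 \<in> invariants G \<rho>"
      using that linear by (simp add: invariants_def linear_combination_matrix_of)
    then have "a *s e1 + b *s e2 = 0 *s e1 + 0 *s e2"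
      using invariants by simp
    then show ?thesis
      by (metis coord_combination)
  qed
  show ?thesis
    using zero[of "mat11 U" "mat21 U"] zero[of "mat12 U" "mat22 U"] fixed
    by (simp add: mat2_eq_iff times_mat2_def zero_mat2_def)
qed

lemma group_representation_iff_group_hom:
  "group_representation G scale \<rho> \<longleftrightarrow>
    vector_space scale \<and> group_hom G (general_linear_group scale) \<rho>"
  using group_general_linear_group[of scale]
  by (auto simp: group_representation_def group_hom_def group_hom_axioms_def)

lemma extremal_representation_matrices:
  fixes G :: "('g, 'm) monoid_scheme" and scale :: "'k::finite_field \<Rightarrow> 'v::ab_group_add \<Rightarrow> 'v"
  assumes extremal: "extremal_representation G H scale \<rho>"
    and finite: "finite (carrier G)" and order: "of_nat (Coset.order G) \<noteq> (0::'k)"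
    and two: "(2::'k) \<noteq> 0"
  obtains S and M :: "('v \<Rightarrow> 'v) \<Rightarrow> 'k mat2" where "extremal_mat2_group S"
    "M \<in> iso (representation_image G scale \<rho>) (mult_monoid S)"
    "M ` \<rho> ` H \<subseteq> line_stabilizer S"
proof -
  have dim: "vector_space.dim scale (UNIV :: 'v set) = 2" and invariants: "invariants G \<rho> = {0}"
    and space: "vector_space scale" and hom: "group_hom G (general_linear_group scale) \<rho>"
    using extremal by (auto simp: extremal_representation_def group_representation_iff_group_hom)
  obtain L where L: "module.subspace scale L" "vector_space.dim scale L = 1"
    and H: "H \<subseteq> setwise_stabilizer G \<rho> L"
    and stabilizer: "setwise_stabilizer G \<rho> L = pointwise_stabilizer G \<rho> L"
    using extremal by (auto simp: extremal_representation_def)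
  obtain e1 e2 where "plane_basis scale e1 e2" and L_span: "L = module.span scale {e1}"
    using vector_space.plane_basis_of_line[OF space dim L] .
  then interpret plane_basis scale e1 e2
    by simp
  let ?S = "matrix_of ` \<rho> ` carrier G"
  have general_linear: "\<rho> g \<in> carrier (general_linear_group scale)" if "g \<in> carrier G" for g
    using group_hom.hom_closed[OF hom that] .
  have fixes_e1: "\<rho> g e1 = e1" if "g \<in> setwise_stabilizer G \<rho> L" for g
    using that stabilizer span_base[of e1 "{e1}"] by (auto simp: pointwise_stabilizer_def L_span)
  have "extremal_mat2_group ?S"
  proof (intro extremal_mat2_group.intro extremal_mat2_group_axioms.intro
      finite_mat2_group_matrix_of_image[OF hom finite order two])
    fix A assume "A \<in> line_stabilizer ?S"
    then obtain g where g: "g \<in> carrier G" "A = matrix_of (\<rho> g)" "mat21 (matrix_of (\<rho> g)) = 0"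
      by (auto simp: line_stabilizer_def)
    then have "g \<in> setwise_stabilizer G \<rho> L"
      using image_line_if_mat21_eq_0 general_linear by (simp add: setwise_stabilizer_def L_span)
    then show "mat11 A = 1"
      using fixes_e1 by (simp add: g(2) matrix_of_def)
  next
    fix U assume "\<And>A. A \<in> ?S \<Longrightarrow> A * U = U"
    then show "U = 0"
      using general_linear
      by (intro invariants_trivial_imp_mat2_eq_0[OF _ invariants])
        (auto simp: general_linear_group_def)
  qed
  moreover have "matrix_of \<in> iso (representation_image G scale \<rho>) (mult_monoid ?S)"
    unfolding representation_image_def using general_linear by (intro iso_matrix_of) auto
  moreover have "matrix_of ` \<rho> ` H \<subseteq> line_stabilizer ?S"
    using H fixes_e1 by (auto simp: line_stabilizer_def setwise_stabilizer_def matrix_of_def)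
  ultimately show ?thesis
    by (rule that)
qed

lemma subgroup_representation_image:
  assumes "group_representation G scale \<rho>" and H: "subgroup H G"
  shows "subgroup (\<rho> ` H) (representation_image G scale \<rho>)"
proof -
  interpret group_hom G "general_linear_group scale" \<rho>
    using assms(1) by (simp add: group_representation_iff_group_hom)
  show ?thesis
    unfolding representation_image_def
    using H.subgroup_incl[OF subgroup_img_is_subgroup[OF H] img_is_subgroup] subgroup.subset[OF H]
    by blast
qed

lemma cong_1_mod_power_multiplicity:
  fixes m n q :: nat
  assumes "n dvd m - 1" "m > 0"
  shows "[m = 1] (mod q ^ multiplicity q n)"
proof -
  have "q ^ multiplicity q n dvd m - 1"
    using multiplicity_dvd assms(1) by (rule dvd_trans)
  then show ?thesis
    using assms(2) by (simp add: cong_altdef_nat)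
qed

lemma of_nat_mod_ring_nonzero:
  assumes "coprime n CARD('p::prime_card)"
  shows "of_nat n \<noteq> (0 :: 'p mod_ring)"
  using coprime_common_divisor[OF assms, of "CARD('p)"] prime_card[where 'a = 'p]
  by (auto simp: of_nat_eq_0_iff_char_dvd)

theorem theorem7p11:
  fixes p :: nat
    and G :: "('g, 'm) monoid_scheme"
    and H :: "'g set"
    and scale :: "'p::prime_card mod_ring \<Rightarrow> 'v::ab_group_add \<Rightarrow> 'v"
    and \<rho> :: "'g \<Rightarrow> 'v \<Rightarrow> 'v"
  defines "Gbar \<equiv> representation_image G scale \<rho>"
    and "Hbar \<equiv> \<rho> ` H"
  assumes p: "p = CARD('p)" "p > 2"
    and G: "group G" "finite (carrier G)" "coprime (Coset.order G) p"
    and H: "subgroup H G"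
    and V: "extremal_representation G H scale \<rho>"
  shows "((\<exists>d\<ge>3. (d dvd p - 1 \<or> d dvd p + 1) \<and>
             Gbar \<cong> integer_mod_group d \<and> Hbar = {\<one>\<^bsub>Gbar\<^esub>}) \<or>
          (\<exists>d'\<ge>3. odd d' \<and> (d' dvd p - 1 \<or> d' dvd p + 1) \<and>
             Gbar \<cong> dihedral_group d' \<and> card Hbar \<le> 2)) \<and>
         (\<forall>s. s = multiplicity 2 (Coset.order Gbar) \<longrightarrow> 4 dvd Coset.order Gbar \<longrightarrow> s \<ge> 2 \<longrightarrow>
            [p = 1] (mod 2 ^ s) \<and> cyclic_group Gbar)"
proof -
  have two: "(2 :: 'p mod_ring) \<noteq> 0"
    using of_nat_mod_ring_nonzero[of 2, where 'p = 'p] prime_odd_nat[of p]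
      prime_card[where 'a = 'p] p by simp
  obtain S and M :: "('v \<Rightarrow> 'v) \<Rightarrow> 'p mod_ring mat2" where "extremal_mat2_group S"
    and M: "M \<in> iso Gbar (mult_monoid S)" "M ` Hbar \<subseteq> line_stabilizer S"
    using of_nat_mod_ring_nonzero[OF G(3)[unfolded p(1)]]
    by (rule extremal_representation_matrices[OF V G(2) _ two, folded Gbar_def Hbar_def])
  then interpret extremal_mat2_group S
    by simp
  have "group Gbar" "subgroup Hbar Gbar"
    using V H group_representation_image subgroup_representation_image
    unfolding Gbar_def Hbar_def extremal_representation_def by blast+
  then show ?thesis
  proof (cases rule: isomorphic_group_cases[OF _ M(1) _ M(2), consumes 2,
        case_names cyclic dihedral])
    case cyclic
    have "[p = 1] (mod 2 ^ multiplicity 2 (Coset.order Gbar))" if "4 dvd Coset.order Gbar"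
      using cyclic(5) dvd_trans[OF _ that, of 2] p by (intro cong_1_mod_power_multiplicity) auto
    then show ?thesis
      using cyclic p by auto
  next
    case (dihedral d)
    have "\<not> 4 dvd Coset.order Gbar"
      using dihedral(2,3) by presburger
    then show ?thesis
      using dihedral p by auto
  qed
qed

end
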